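(* The coproduct $\Delta$ on $\mathbf{PQSym}^{(l)}$ is an algebra homomorphism, so that $\mathbf{PQSym}^{(l)}$ is a graded bialgebra. Moreover, it is a Hopf algebra.
   Context: A parking function of length $n\ge0$ is a word $\mathbf a=a_1\cdots a_n$ of length $n$ on $[n]=\{1,\dots,n\}$ whose nondecreasing rearrangement $a'_1\cdots a'_n$ satisfies $a'_i\le i$ for all $i$. An integer $0\le b\le n$ is a breakpoint of $\mathbf a$ if $|\{i:a_i\le b\}|=b$; $BP(\mathbf a)$ denotes the set of breakpoints ($0$ and $n$ always belong to it). Parkization: for a word $w=w_1\cdots w_n$ over the positive integers, let $d(w)=\min\{i\ge1:|\{j:w_j\le i\}|<i\}$. If $d(w)=n+1$, then $w$ is a parking function and $\mathrm{Park}(w)=w$; otherwise let $w'$ be the word obtained from $w$ by decreasing by $1$ all letters greater than $d(w)$, and set $\mathrm{Park}(w)=\mathrm{Park}(w')$ (this terminates). The convolution $\mathbf a'*\mathbf a''$ of two parking functions is the set of parking functions $\mathbf a$ of length $|\mathbf a'|+|\mathbf a''|$ such that the parkization of the first $|\mathbf a'|$ letters of $\mathbf a$ is $\mathbf a'$ and the parkization of the remaining letters is $\mathbf a''$. Fix $l\ge1$. A colored parking function of level $l$ and size $n$ is a pair $(\mathbf a,u)$ of a parking function $\mathbf a$ of length $n$ and a word $u$ of length $n$ on $[l]$. $\mathbf{PQSym}^{(l)}$ is the $\mathbb C$-vector space with basis $(\mathbf G_{(\mathbf a,u)})$ indexed by all colored parking functions of level $l$, graded by size, with product $$\mathbf G_{(\mathbf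 a',u')}\mathbf G_{(\mathbf a'',u'')}=\sum_{\mathbf a\in\mathbf a'*\mathbf a''}\mathbf G_{(\mathbf a,u'\cdot u'')}$$ ($u'\cdot u''$ is concatenation), unit $\mathbf G_{(\emptyset,\emptyset)}$, coproduct $$\Delta\mathbf G_{(\mathbf a,u)}=\sum_{i\in BP(\mathbf a)}\mathbf G_{(\mathbf a,u)_{[1,i]}}\otimes\mathbf G_{(\mathbf a,u)_{[i+1,n]}},$$ where $n$ is the size of $\mathbf a$ and $(\mathbf a,u)_{[a,b]}=(\mathrm{Park}(\mathbf a'),u')$ with $\mathbf a'$ the subword of $\mathbf a$ consisting of the letters (values) in $[a,b]$ and $u'$ the subword of $u$ at the same positions, and counit the projection onto degree $0$. *)

theory Defs
  imports Complex_Main "HOL-Library.Poly_Mapping"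
begin

section \<open>Complex vector spaces with a distinguished basis\<close>

text \<open>
  The space with basis \<^term>\<open>B\<close> consists of the finitely supported functions into the complex
  numbers whose support lies in \<^term>\<open>B\<close>. The tensor product of the spaces with bases
  \<^term>\<open>B\<close> and \<^term>\<open>C\<close> is the space with basis \<^term>\<open>B \<times> C\<close>; the pair \<^term>\<open>(b, c)\<close>
  stands for the tensor product of the basis vectors \<^term>\<open>b\<close> and \<^term>\<open>c\<close>.
\<close>

definition scale :: "complex \<Rightarrow> ('b \<Rightarrow>\<^sub>0 complex) \<Rightarrow> ('b \<Rightarrow>\<^sub>0 complex)" where
  "scale c x = Poly_Mapping.map ((*) c) x"

lemma lookup_scale [simp]: "Poly_Mapping.lookup (scale c x) b = c * Poly_Mapping.lookup x b"
  by (simp add: scale_def Poly_Mapping.map.rep_eq when_def)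

lemma vector_space_scale: "vector_space scale"
  by unfold_locales (auto intro!: poly_mapping_eqI simp: lookup_add algebra_simps)

definition basis_vec :: "'b \<Rightarrow> ('b \<Rightarrow>\<^sub>0 complex)" where
  "basis_vec b = Poly_Mapping.single b 1"

definition space_on :: "'b set \<Rightarrow> ('b \<Rightarrow>\<^sub>0 complex) set" where
  "space_on B = {x. Poly_Mapping.keys x \<subseteq> B}"

definition lin_ext :: "('b \<Rightarrow> ('c \<Rightarrow>\<^sub>0 complex)) \<Rightarrow> ('b \<Rightarrow>\<^sub>0 complex) \<Rightarrow> ('c \<Rightarrow>\<^sub>0 complex)" where
  "lin_ext f x = (\<Sum>b\<in>Poly_Mapping.keys x. scale (Poly_Mapping.lookup x b) (f b))"

definition bilin_ext ::
  "('b \<Rightarrow> 'c \<Rightarrow> ('d \<Rightarrow>\<^sub>0 complex)) \<Rightarrow> ('b \<Rightarrow>\<^sub>0 complex) \<Rightarrow> ('c \<Rightarrow>\<^sub>0 complex) \<Rightarrow> ('d \<Rightarrow>\<^sub>0 complex)"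
where
  "bilin_ext f x y =
     (\<Sum>b\<in>Poly_Mapping.keys x. \<Sum>c\<in>Poly_Mapping.keys y.
        scale (Poly_Mapping.lookup x b * Poly_Mapping.lookup y c) (f b c))"

definition tensor :: "('b \<Rightarrow>\<^sub>0 complex) \<Rightarrow> ('c \<Rightarrow>\<^sub>0 complex) \<Rightarrow> (('b \<times> 'c) \<Rightarrow>\<^sub>0 complex)" where
  "tensor = bilin_ext (\<lambda>b c. basis_vec (b, c))"

definition tensor_map ::
  "(('b \<Rightarrow>\<^sub>0 complex) \<Rightarrow> ('c \<Rightarrow>\<^sub>0 complex)) \<Rightarrow> (('d \<Rightarrow>\<^sub>0 complex) \<Rightarrow> ('e \<Rightarrow>\<^sub>0 complex))
   \<Rightarrow> (('b \<times> 'd) \<Rightarrow>\<^sub>0 complex) \<Rightarrow> (('c \<times> 'e) \<Rightarrow>\<^sub>0 complex)" where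
  "tensor_map f g = lin_ext (\<lambda>(b, d). tensor (f (basis_vec b)) (g (basis_vec d)))"

definition tensor_assoc :: "((('b \<times> 'c) \<times> 'd) \<Rightarrow>\<^sub>0 complex) \<Rightarrow> (('b \<times> 'c \<times> 'd) \<Rightarrow>\<^sub>0 complex)" where
  "tensor_assoc = lin_ext (\<lambda>((b, c), d). basis_vec (b, c, d))"

text \<open>The linear map on the tensor square induced by a bilinear multiplication.\<close>

definition mult_lin ::
  "(('b \<Rightarrow>\<^sub>0 complex) \<Rightarrow> ('b \<Rightarrow>\<^sub>0 complex) \<Rightarrow> ('b \<Rightarrow>\<^sub>0 complex))
   \<Rightarrow> (('b \<times> 'b) \<Rightarrow>\<^sub>0 complex) \<Rightarrow> ('b \<Rightarrow>\<^sub>0 complex)" where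
  "mult_lin m = lin_ext (\<lambda>(b, c). m (basis_vec b) (basis_vec c))"

text \<open>Multiplication of the tensor square of an algebra: componentwise on pure tensors.\<close>

definition tensor_mult ::
  "(('b \<Rightarrow>\<^sub>0 complex) \<Rightarrow> ('b \<Rightarrow>\<^sub>0 complex) \<Rightarrow> ('b \<Rightarrow>\<^sub>0 complex))
   \<Rightarrow> (('b \<times> 'b) \<Rightarrow>\<^sub>0 complex) \<Rightarrow> (('b \<times> 'b) \<Rightarrow>\<^sub>0 complex) \<Rightarrow> (('b \<times> 'b) \<Rightarrow>\<^sub>0 complex)" where
  "tensor_mult m = bilin_ext (\<lambda>(a, b) (c, d).
     tensor (m (basis_vec a) (basis_vec c)) (m (basis_vec b) (basis_vec d)))"


section \<open>Algebras, coalgebras, bialgebras, Hopf algebras\<close>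

text \<open>
  Linearity on a subspace \<^term>\<open>V\<close>, for arbitrary scalar multiplications \<^term>\<open>s\<close>, \<^term>\<open>t\<close>, so
  that complex-valued functionals are covered by taking multiplication for \<^term>\<open>t\<close>.
\<close>

definition linear_on ::
  "(complex \<Rightarrow> 'v \<Rightarrow> 'v) \<Rightarrow> (complex \<Rightarrow> 'w \<Rightarrow> 'w) \<Rightarrow> 'v set \<Rightarrow> ('v::ab_group_add \<Rightarrow> 'w::ab_group_add) \<Rightarrow> bool"
where
  "linear_on s t V f \<longleftrightarrow>
     (\<forall>x\<in>V. \<forall>y\<in>V. f (x + y) = f x + f y) \<and> (\<forall>c. \<forall>x\<in>V. f (s c x) = t c (f x))"

definition algebra_hom ::
  "(complex \<Rightarrow> 'v \<Rightarrow> 'v) \<Rightarrow> 'v set \<Rightarrow> ('v \<Rightarrow> 'v \<Rightarrow> 'v) \<Rightarrow> 'v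
   \<Rightarrow> (complex \<Rightarrow> 'w \<Rightarrow> 'w) \<Rightarrow> 'w set \<Rightarrow> ('w \<Rightarrow> 'w \<Rightarrow> 'w) \<Rightarrow> 'w
   \<Rightarrow> ('v::ab_group_add \<Rightarrow> 'w::ab_group_add) \<Rightarrow> bool"
where
  "algebra_hom s V m e t W m' e' f \<longleftrightarrow>
     linear_on s t V f \<and> f ` V \<subseteq> W \<and>
     (\<forall>x\<in>V. \<forall>y\<in>V. f (m x y) = m' (f x) (f y)) \<and> f e = e'"

locale algebra_on =
  fixes B :: "'b set"
    and mult :: "('b \<Rightarrow>\<^sub>0 complex) \<Rightarrow> ('b \<Rightarrow>\<^sub>0 complex) \<Rightarrow> ('b \<Rightarrow>\<^sub>0 complex)"
    and one :: "'b \<Rightarrow>\<^sub>0 complex"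
  assumes mult_closed: "\<lbrakk>x \<in> space_on B; y \<in> space_on B\<rbrakk> \<Longrightarrow> mult x y \<in> space_on B"
    and one_closed: "one \<in> space_on B"
    and mult_linear_left: "y \<in> space_on B \<Longrightarrow> linear_on scale scale (space_on B) (\<lambda>x. mult x y)"
    and mult_linear_right: "x \<in> space_on B \<Longrightarrow> linear_on scale scale (space_on B) (mult x)"
    and mult_assoc: "\<lbrakk>x \<in> space_on B; y \<in> space_on B; z \<in> space_on B\<rbrakk>
          \<Longrightarrow> mult (mult x y) z = mult x (mult y z)"
    and mult_one_left: "x \<in> space_on B \<Longrightarrow> mult one x = x"
    and mult_one_right: "x \<in> space_on B \<Longrightarrow> mult x one = x"

locale coalgebra_on =
  fixes B :: "'b set"
    and comult :: "('b \<Rightarrow>\<^sub>0 complex) \<Rightarrow> (('b \<times> 'b) \<Rightarrow>\<^sub>0 complex)"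
    and counit :: "('b \<Rightarrow>\<^sub>0 complex) \<Rightarrow> complex"
  assumes comult_closed: "x \<in> space_on B \<Longrightarrow> comult x \<in> space_on (B \<times> B)"
    and comult_linear: "linear_on scale scale (space_on B) comult"
    and counit_linear: "linear_on scale (*) (space_on B) counit"
    and coassoc: "x \<in> space_on B \<Longrightarrow>
          tensor_assoc (tensor_map comult id (comult x)) = tensor_map id comult (comult x)"
    and counit_left: "x \<in> space_on B \<Longrightarrow>
          lin_ext (\<lambda>(b, c). scale (counit (basis_vec b)) (basis_vec c)) (comult x) = x"
    and counit_right: "x \<in> space_on B \<Longrightarrow>
          lin_ext (\<lambda>(b, c). scale (counit (basis_vec c)) (basis_vec b)) (comult x) = x"

locale bialgebra_on = algebra_on B mult one + coalgebra_on B comult counit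
  for B :: "'b set" and mult one comult counit +
  assumes comult_hom: "algebra_hom scale (space_on B) mult one
            scale (space_on (B \<times> B)) (tensor_mult mult) (tensor one one) comult"
    and counit_hom: "algebra_hom scale (space_on B) mult one (*) UNIV (*) 1 counit"

text \<open>
  The grading is given by a degree function on the basis: the component of degree \<^term>\<open>n\<close> is
  spanned by the basis elements of degree \<^term>\<open>n\<close>, so that the space is the direct sum of its
  components. The base field is concentrated in degree \<^term>\<open>0::nat\<close>.
\<close>

locale graded_bialgebra_on = bialgebra_on B mult one comult counit
  for B :: "'b set" and mult one comult counit +
  fixes deg :: "'b \<Rightarrow> nat"
  assumes mult_graded:
      "\<lbrakk>x \<in> space_on {b\<in>B. deg b = m}; y \<in> space_on {b\<in>B. deg b = n}\<rbrakk>
        \<Longrightarrow> mult x y \<in> space_on {b\<in>B. deg b = m + n}"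
    and one_graded: "one \<in> space_on {b\<in>B. deg b = 0}"
    and comult_graded:
      "x \<in> space_on {b\<in>B. deg b = n}
        \<Longrightarrow> comult x \<in> space_on {(b, c) \<in> B \<times> B. deg b + deg c = n}"
    and counit_graded: "\<lbrakk>x \<in> space_on {b\<in>B. deg b = n}; n \<noteq> 0\<rbrakk> \<Longrightarrow> counit x = 0"

locale hopf_algebra_on = bialgebra_on B mult one comult counit
  for B :: "'b set" and mult one comult counit +
  assumes antipode: "\<exists>S. linear_on scale scale (space_on B) S \<and> S ` space_on B \<subseteq> space_on B \<and>
      (\<forall>x\<in>space_on B.
         mult_lin mult (tensor_map S id (comult x)) = scale (counit x) one \<and>
         mult_lin mult (tensor_map id S (comult x)) = scale (counit x) one)"


section \<open>Parking functions\<close>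

definition parking_function :: "nat list \<Rightarrow> bool" where
  "parking_function a \<longleftrightarrow>
     set a \<subseteq> {1..length a} \<and> (\<forall>i\<in>{1..length a}. sort a ! (i - 1) \<le> i)"

definition breakpoints :: "nat list \<Rightarrow> nat set" where
  "breakpoints a = {b. b \<le> length a \<and> card {i. i < length a \<and> a ! i \<le> b} = b}"

definition park_defect :: "nat list \<Rightarrow> nat" where
  "park_defect w = (LEAST i. 1 \<le> i \<and> card {j. j < length w \<and> w ! j \<le> i} < i)"

lemma park_defect:
  "1 \<le> park_defect w"
  "card {j. j < length w \<and> w ! j \<le> park_defect w} < park_defect w"
  "park_defect w \<le> length w + 1"
proof -
  let ?P = "\<lambda>i. 1 \<le> i \<and> card {j. j < length w \<and> w ! j \<le> i} < i"
  have "card {j. j < length w \<and> w ! j \<le> length w + 1} \<le> card {..<length w}"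
    by (rule card_mono) auto
  then have P: "?P (length w + 1)" by simp
  from LeastI[of ?P, OF P] show "1 \<le> park_defect w"
    and "card {j. j < length w \<and> w ! j \<le> park_defect w} < park_defect w"
    unfolding park_defect_def by blast+
  from Least_le[of ?P, OF P] show "park_defect w \<le> length w + 1"
    unfolding park_defect_def .
qed

function park :: "nat list \<Rightarrow> nat list" where
  "park w = (if park_defect w = length w + 1 then w
     else park (map (\<lambda>x. if x > park_defect w then x - 1 else x) w))"
  by auto

termination
proof (relation "measure sum_list")
  fix w :: "nat list"
  let ?f = "\<lambda>x. if x > park_defect w then x - 1 else x"
  assume "park_defect w \<noteq> length w + 1"
  with park_defect[of w] have less: "card {j. j < length w \<and> w ! j \<le> park_defect w} < length w"
    by linarith
  have "\<exists>x\<in>set w. x > park_defect w"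
  proof (rule ccontr)
    assume "\<not> ?thesis"
    then have "{j. j < length w \<and> w ! j \<le> park_defect w} = {..<length w}"
      by (auto simp: not_less)
    with less show False by simp
  qed
  then obtain x where x: "x \<in> set w" "x > park_defect w" by blast
  have le: "sum_list (map ?f v) \<le> sum_list v" for v
    using sum_list_mono[of v ?f id] by simp
  have "sum_list (map ?f v) < sum_list v" if "x \<in> set v" for v
    using that
  proof (induction v)
    case (Cons y v)
    with le[of v] x(2) show ?case by (cases "x = y") auto
  qed simp
  then have "sum_list (map ?f w) < sum_list w"
    using x(1) by blast
  then show "(map ?f w, w) \<in> measure sum_list" by simp
qed simp

declare park.simps [simp del]

definition convolution :: "nat list \<Rightarrow> nat list \<Rightarrow> nat list set" where
  "convolution a' a'' = {a. parking_function a \<and> length a = length a' + length a'' \<and>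
     park (take (length a') a) = a' \<and> park (drop (length a') a) = a''}"


section \<open>Colored parking functions and their Hopf algebra\<close>

type_synonym colored_word = "nat list \<times> nat list"

definition colored_parking_functions :: "nat \<Rightarrow> colored_word set" where
  "colored_parking_functions l =
     {(a, u). parking_function a \<and> length u = length a \<and> set u \<subseteq> {1..l}}"

definition csize :: "colored_word \<Rightarrow> nat" where
  "csize p = length (fst p)"

text \<open>\<open>crestrict p i j\<close> keeps the letters with \<^emph>\<open>values\<close> in \<open>[i, j]\<close>, with their colors.\<close>

definition crestrict :: "colored_word \<Rightarrow> nat \<Rightarrow> nat \<Rightarrow> colored_word" where
  "crestrict = (\<lambda>(a, u) i j.
     let K = {k. k < length a \<and> a ! k \<in> {i..j}} in (park (nths a K), nths u K))"

abbreviation PQSym :: "nat \<Rightarrow> (colored_word \<Rightarrow>\<^sub>0 complex) set" where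
  "PQSym l \<equiv> space_on (colored_parking_functions l)"

text \<open>
  The structure maps do not mention the level; for level \<^term>\<open>l\<close> they are used only on
  \<^term>\<open>PQSym l\<close>.
\<close>

definition pq_mult ::
  "(colored_word \<Rightarrow>\<^sub>0 complex) \<Rightarrow> (colored_word \<Rightarrow>\<^sub>0 complex) \<Rightarrow> (colored_word \<Rightarrow>\<^sub>0 complex)" where
  "pq_mult = bilin_ext (\<lambda>(a', u') (a'', u'').
     \<Sum>a\<in>convolution a' a''. basis_vec (a, u' @ u''))"

definition pq_one :: "colored_word \<Rightarrow>\<^sub>0 complex" where
  "pq_one = basis_vec ([], [])"

definition pq_comult ::
  "(colored_word \<Rightarrow>\<^sub>0 complex) \<Rightarrow> ((colored_word \<times> colored_word) \<Rightarrow>\<^sub>0 complex)" where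
  "pq_comult = lin_ext (\<lambda>p. \<Sum>i\<in>breakpoints (fst p).
     tensor (basis_vec (crestrict p 1 i)) (basis_vec (crestrict p (i + 1) (csize p))))"

text \<open>The component of degree \<^term>\<open>0::nat\<close> is spanned by the unit.\<close>

definition pq_counit :: "(colored_word \<Rightarrow>\<^sub>0 complex) \<Rightarrow> complex" where
  "pq_counit x = Poly_Mapping.lookup x ([], [])"

end

theory Submission
  imports Defs "HOL-Library.Multiset"
begin

text \<open>
  Parkization acts letterwise by \<open>x \<mapsto> x - Max {y - c(y) | y < x}\<close>, where \<open>c(y)\<close> counts the letters
  at most \<open>y\<close>. It therefore commutes with passing to subwords, which gives associativity. If \<open>i\<close> is a
  breakpoint of a parking function \<open>z = v w\<close>, then the formula shows that parkization sends the
  letters of \<open>v\<close> up to \<open>i\<close> to letters up to \<open>i1\<close>, their number, and the others to larger letters, so that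
  \<open>i1\<close> is a breakpoint of \<open>Park v\<close>; likewise for \<open>w\<close>. Hence cutting \<open>z\<close> at \<open>i = i1 + i2\<close> is a bijection
  between the terms of \<open>\<Delta>(xy)\<close> and those of \<open>\<Delta>(x)\<Delta>(y)\<close>: the position of the small letters of \<open>z\<close> is read
  off from the two factors, and the two pieces then determine \<open>z\<close>. The antipode exists because the
  bialgebra is graded and connected: the left and right convolution inverses of the identity are
  computed by recursion on the size.
\<close>

section \<open>Linear and bilinear extension\<close>

text \<open>The obstacle is that \<open>park\<close> lowers letters at the first defect of the whole
  word, while a subword has other first defects, so the two recursions cannot be run in parallel.
  What matters about a first defect \<open>d\<close> of \<open>w\<close> is only that the difference
  of \<open>y\<close> and \<open>cnt w y\<close> is strictly larger at \<open>d\<close> than at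
  every \<open>y < d\<close>. This record property passes to subwords, because counts increase less
  there. Hence one lowering step of a word leaves \<open>map (park_letter v) v\<close> unchanged for
  each of its subwords \<open>v\<close>, although it need not be a parkization step of
  \<open>v\<close>. Counts see only the multiset of letters, so subwords enter as multiset
  inclusions.

  The structure maps are extended linearly to all finitely supported functions. Linearity therefore
  never depends on membership in \<open>PQSym l\<close>, and every identity can be checked on basis
  vectors.\<close>

lemma scale_zero_left [simp]: "scale 0 x = 0"
  by (auto intro!: poly_mapping_eqI)

lemma scale_zero_right [simp]: "scale c 0 = 0"
  by (auto intro!: poly_mapping_eqI)

lemma scale_one [simp]: "scale 1 x = x"
  by (auto intro!: poly_mapping_eqI)

lemma scale_scale [simp]: "scale c (scale d x) = scale (c * d) x"
  by (auto intro!: poly_mapping_eqI)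

lemma scale_add_left: "scale (c + d) x = scale c x + scale d x"
  by (auto intro!: poly_mapping_eqI simp: lookup_add algebra_simps)

lemma scale_add_right: "scale c (x + y) = scale c x + scale c y"
  by (auto intro!: poly_mapping_eqI simp: lookup_add algebra_simps)

lemma scale_sum_right: "scale c (sum f A) = (\<Sum>a\<in>A. scale c (f a))"
  by (induction A rule: infinite_finite_induct) (auto simp: scale_add_right)

lemma lookup_basis_vec: "Poly_Mapping.lookup (basis_vec b) c = (if b = c then 1 else 0)"
  by (simp add: basis_vec_def lookup_single when_def)

lemma keys_basis_vec [simp]: "Poly_Mapping.keys (basis_vec b) = {b}"
  by (simp add: basis_vec_def)

lemma basis_vec_in_space_on [simp]: "basis_vec b \<in> space_on B \<longleftrightarrow> b \<in> B"
  by (simp add: space_on_def)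

lemma zero_in_space_on [simp]: "0 \<in> space_on B"
  by (simp add: space_on_def)

lemma space_on_add: "x \<in> space_on B \<Longrightarrow> y \<in> space_on B \<Longrightarrow> x + y \<in> space_on B"
  using Poly_Mapping.keys_add[of x y] by (auto simp: space_on_def)

lemma space_on_scale: "x \<in> space_on B \<Longrightarrow> scale c x \<in> space_on B"
  by (auto simp: space_on_def in_keys_iff)

lemma space_on_uminus: "x \<in> space_on B \<Longrightarrow> - x \<in> space_on B"
  by (auto simp: space_on_def in_keys_iff)

lemma space_on_sum: "(\<And>a. a \<in> A \<Longrightarrow> f a \<in> space_on B) \<Longrightarrow> sum f A \<in> space_on B"
  by (induction A rule: infinite_finite_induct) (auto intro: space_on_add)

lemma lin_ext_superset:
  assumes "finite A" "Poly_Mapping.keys x \<subseteq> A"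
  shows "lin_ext f x = (\<Sum>b\<in>A. scale (Poly_Mapping.lookup x b) (f b))"
  unfolding lin_ext_def using assms by (intro sum.mono_neutral_left) (auto simp: in_keys_iff)

lemma lin_ext_add: "lin_ext f (x + y) = lin_ext f x + lin_ext f y"
proof -
  let ?A = "Poly_Mapping.keys x \<union> Poly_Mapping.keys y"
  show ?thesis
    using lin_ext_superset[of ?A x f] lin_ext_superset[of ?A y f] lin_ext_superset[of ?A "x + y" f]
      Poly_Mapping.keys_add[of x y]
    by (simp add: lookup_add scale_add_left sum.distrib)
qed

lemma lin_ext_zero [simp]: "lin_ext f 0 = 0"
  by (simp add: lin_ext_def)

lemma lin_ext_scale: "lin_ext f (scale c x) = scale c (lin_ext f x)"
proof -
  have "Poly_Mapping.keys (scale c x) \<subseteq> Poly_Mapping.keys x" by (auto simp: in_keys_iff)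
  then show ?thesis
    using lin_ext_superset[of "Poly_Mapping.keys x" "scale c x" f]
    by (simp add: lin_ext_def scale_sum_right)
qed

lemma lin_ext_sum: "lin_ext f (sum g A) = (\<Sum>a\<in>A. lin_ext f (g a))"
  by (induction A rule: infinite_finite_induct) (auto simp: lin_ext_add)

lemma lin_ext_basis_vec [simp]: "lin_ext f (basis_vec b) = f b"
  by (simp add: lin_ext_def lookup_basis_vec)

lemma lin_ext_basis_vec_ident [simp]: "lin_ext basis_vec x = x"
proof (rule poly_mapping_eqI)
  fix b
  have "Poly_Mapping.lookup (lin_ext basis_vec x) b =
      (\<Sum>a\<in>Poly_Mapping.keys x. if a = b then Poly_Mapping.lookup x a else 0)"
    by (simp add: lin_ext_def lookup_sum lookup_basis_vec if_distrib cong: if_cong)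
  also have "\<dots> = Poly_Mapping.lookup x b"
    by (simp add: sum.delta in_keys_iff)
  finally show "Poly_Mapping.lookup (lin_ext basis_vec x) b = Poly_Mapping.lookup x b" .
qed

lemma basis_expansion: "x = (\<Sum>b\<in>Poly_Mapping.keys x. scale (Poly_Mapping.lookup x b) (basis_vec b))"
  using lin_ext_basis_vec_ident[of x] by (simp only: lin_ext_def)

lemma lin_ext_in_space_on:
  "x \<in> space_on B \<Longrightarrow> (\<And>b. b \<in> B \<Longrightarrow> f b \<in> space_on C) \<Longrightarrow> lin_ext f x \<in> space_on C"
  unfolding lin_ext_def by (intro space_on_sum space_on_scale) (auto simp: space_on_def)

lemma bilin_ext_eq: "bilin_ext f x y = lin_ext (\<lambda>b. lin_ext (f b) y) x"
  by (simp add: bilin_ext_def lin_ext_def scale_sum_right)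

lemma bilin_ext_basis_vec [simp]: "bilin_ext f (basis_vec b) (basis_vec c) = f b c"
  by (simp add: bilin_ext_eq)

lemma bilin_ext_add_left: "bilin_ext f (x + x') y = bilin_ext f x y + bilin_ext f x' y"
  by (simp add: bilin_ext_eq lin_ext_add)

lemma bilin_ext_scale_left: "bilin_ext f (scale c x) y = scale c (bilin_ext f x y)"
  by (simp add: bilin_ext_eq lin_ext_scale)

lemma bilin_ext_sum_left: "bilin_ext f (sum g A) y = (\<Sum>a\<in>A. bilin_ext f (g a) y)"
  by (simp add: bilin_ext_eq lin_ext_sum)

lemma bilin_ext_add_right: "bilin_ext f x (y + y') = bilin_ext f x y + bilin_ext f x y'"
  unfolding bilin_ext_eq by (simp add: lin_ext_def[of _ x] lin_ext_add scale_add_right sum.distrib)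

lemma bilin_ext_scale_right: "bilin_ext f x (scale c y) = scale c (bilin_ext f x y)"
  unfolding bilin_ext_eq
  by (simp add: lin_ext_def[of _ x] lin_ext_scale scale_sum_right mult.commute)

lemma bilin_ext_zero_left [simp]: "bilin_ext f 0 y = 0"
  by (simp add: bilin_ext_def)

lemma bilin_ext_zero_right [simp]: "bilin_ext f x 0 = 0"
  by (simp add: bilin_ext_def)

lemma bilin_ext_sum_right: "bilin_ext f x (sum g A) = (\<Sum>a\<in>A. bilin_ext f x (g a))"
  by (induction A rule: infinite_finite_induct) (auto simp: bilin_ext_add_right)

lemma bilin_ext_in_space_on:
  "x \<in> space_on B \<Longrightarrow> y \<in> space_on C \<Longrightarrow> (\<And>b c. b \<in> B \<Longrightarrow> c \<in> C \<Longrightarrow> f b c \<in> space_on D)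
   \<Longrightarrow> bilin_ext f x y \<in> space_on D"
  unfolding bilin_ext_eq by (intro lin_ext_in_space_on[of _ B] lin_ext_in_space_on[of _ C])

lemma linear_on_lin_ext: "linear_on scale scale V (lin_ext f)"
  by (simp add: linear_on_def lin_ext_add lin_ext_scale)

lemma linear_on_bilin_ext_left: "linear_on scale scale V (\<lambda>x. bilin_ext f x y)"
  by (simp add: linear_on_def bilin_ext_add_left bilin_ext_scale_left)

lemma linear_on_bilin_ext_right: "linear_on scale scale V (bilin_ext f x)"
  by (simp add: linear_on_def bilin_ext_add_right bilin_ext_scale_right)

lemma linear_on_ident: "linear_on s s V (\<lambda>x. x)"
  by (simp add: linear_on_def)

lemma linear_on_compose:
  "linear_on t r UNIV f \<Longrightarrow> linear_on s t UNIV g \<Longrightarrow> linear_on s r UNIV (\<lambda>x. f (g x))"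
  by (simp add: linear_on_def)

lemma linear_on_subset: "linear_on s t W f \<Longrightarrow> V \<subseteq> W \<Longrightarrow> linear_on s t V f"
  unfolding linear_on_def by blast

lemma linear_on_sum:
  assumes "linear_on s t UNIV f"
  shows "f (sum g A) = (\<Sum>a\<in>A. f (g a))"
proof -
  have "f 0 = 0"
    using assms[unfolded linear_on_def] by (metis UNIV_I add_cancel_left_left)
  then show ?thesis
    using assms by (induction A rule: infinite_finite_induct) (auto simp: linear_on_def)
qed

text \<open>The target scalar multiplication \<open>t\<close> is left open to cover the
  complex-valued counit. Linearity is required on the whole source type, which makes it stable under
  composition without closure conditions.\<close>

lemma linear_on_eqI:
  assumes f: "linear_on scale t UNIV f" and g: "linear_on scale t UNIV g"
    and x: "x \<in> space_on B" and eq: "\<And>b. b \<in> B \<Longrightarrow> f (basis_vec b) = g (basis_vec b)"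
  shows "f x = g x"
proof -
  have sc: "f (scale c y) = t c (f y)" "g (scale c y) = t c (g y)" for c y
    using f g by (simp_all add: linear_on_def)
  have "f (\<Sum>b\<in>Poly_Mapping.keys x. scale (Poly_Mapping.lookup x b) (basis_vec b)) =
      g (\<Sum>b\<in>Poly_Mapping.keys x. scale (Poly_Mapping.lookup x b) (basis_vec b))"
    unfolding linear_on_sum[OF f] linear_on_sum[OF g] sc
    using x by (intro sum.cong) (auto simp: eq space_on_def)
  then show ?thesis using basis_expansion[of x] by metis
qed

lemma bilinear_on_eqI:
  assumes "\<And>y. linear_on scale t UNIV (\<lambda>x. f x y)" "\<And>x. linear_on scale t UNIV (f x)"
    and "\<And>y. linear_on scale t UNIV (\<lambda>x. g x y)" "\<And>x. linear_on scale t UNIV (g x)"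
    and x: "x \<in> space_on B" and y: "y \<in> space_on C"
    and eq: "\<And>b c. b \<in> B \<Longrightarrow> c \<in> C \<Longrightarrow> f (basis_vec b) (basis_vec c) = g (basis_vec b) (basis_vec c)"
  shows "f x y = g x y"
  using assms(1,3) x
proof (rule linear_on_eqI)
  show "f (basis_vec b) y = g (basis_vec b) y" if "b \<in> B" for b
    using assms(2,4) y by (rule linear_on_eqI) (rule eq[OF that])
qed

lemma tensor_basis_vec [simp]: "tensor (basis_vec b) (basis_vec c) = basis_vec (b, c)"
  by (simp add: tensor_def)

lemma lin_ext_tensor: "lin_ext h (tensor x y) = bilin_ext (\<lambda>b c. h (b, c)) x y"
  by (simp add: tensor_def bilin_ext_def lin_ext_sum lin_ext_scale)

section \<open>An explicit formula for parkization\<close>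

definition cnt :: "nat list \<Rightarrow> nat \<Rightarrow> nat" where
  "cnt w y = length (filter (\<lambda>x. x \<le> y) w)"

lemma card_le_eq_cnt: "card {j. j < length w \<and> w ! j \<le> y} = cnt w y"
  by (simp add: cnt_def length_filter_conv_card)

lemma cnt_le_length: "cnt w y \<le> length w"
  by (simp add: cnt_def)

lemma cnt_eq_length_iff: "cnt w y = length w \<longleftrightarrow> (\<forall>x\<in>set w. x \<le> y)"
proof -
  have "filter (\<lambda>x. x \<le> y) w = w" if "length (filter (\<lambda>x. x \<le> y) w) = length w"
    using that by (metis length_filter_less nat_less_le filter_True)
  then show ?thesis unfolding cnt_def by (metis filter_id_conv)
qed

lemma cnt_append: "cnt (v @ w) y = cnt v y + cnt w y"
  by (simp add: cnt_def)

lemma cnt_eq_size: "cnt w y = size (filter_mset (\<lambda>x. x \<le> y) (mset w))"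
  by (simp add: cnt_def flip: mset_filter)

lemma cnt_mono: "x \<le> y \<Longrightarrow> cnt w x \<le> cnt w y"
  by (induction w) (auto simp: cnt_def)

lemma cnt_strict_mono: "x \<in> set w \<Longrightarrow> y < x \<Longrightarrow> cnt w y < cnt w x"
proof (induction w)
  case (Cons a w)
  then show ?case using cnt_mono[of y x w] by (auto simp: cnt_def)
qed simp

text \<open>The letters of \<open>w\<close> outside \<open>v\<close> have monotone counts, so
  \<open>v\<close> gains no more letters than \<open>w\<close> between \<open>x\<close> and
  \<open>y\<close>. The additive form avoids truncated subtraction.\<close>

lemma cnt_submset:
  assumes "mset v \<subseteq># mset w" "x \<le> y"
  shows "cnt v y + cnt w x \<le> cnt w y + cnt v x"
proof -
  from assms obtain u where "mset w = mset v + mset u"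
    by (metis mset_subset_eq_exists_conv ex_mset)
  then have "cnt w z = cnt v z + cnt u z" for z by (simp add: cnt_eq_size)
  then show ?thesis using cnt_mono[OF assms(2), of u] by simp
qed

text \<open>The \<open>i\<close>-th smallest letter is at most \<open>i\<close> exactly when at
  least \<open>i\<close> letters are. Only 0 has to be excluded separately, since
  \<open>i = length a\<close> already bounds all letters from above.\<close>

lemma parking_function_iff:
  "parking_function a \<longleftrightarrow> 0 \<notin> set a \<and> (\<forall>i\<le>length a. i \<le> cnt a i)"
proof -
  have key: "sort a ! (i - 1) \<le> i \<longleftrightarrow> i \<le> cnt a i" if i: "1 \<le> i" "i \<le> length a" for i
  proof -
    define s where "s = sort a"
    have s: "sorted s" "length s = length a" by (simp_all add: s_def)
    have "cnt a i = cnt s i" by (simp add: s_def cnt_eq_size)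
    \<comment> \<open>The sorted letter at position \<open>i - 1\<close> decides: if it is at most
      \<open>i\<close>, so are the \<open>i - 1\<close> letters before it; otherwise all later
      letters exceed \<open>i\<close>, and at most the first \<open>i - 1\<close> count.\<close>
    also have "cnt s i = cnt (take (i - 1) s) i + cnt (drop (i - 1) s) i"
      by (metis append_take_drop_id cnt_append)
    also have "drop (i - 1) s = s ! (i - 1) # drop i s"
      using i s(2) Cons_nth_drop_Suc[of "i - 1" s] by simp
    finally have c: "cnt a i = cnt (take (i - 1) s) i + cnt (s ! (i - 1) # drop i s) i" .
    show ?thesis
    proof (cases "s ! (i - 1) \<le> i")
      case True
      have "x \<le> i" if "x \<in> set (take (i - 1) s)" for x
      proof -
        from that obtain k where "k < i - 1" "k < length s" "x = s ! k"
          by (auto simp: in_set_conv_nth)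
        with sorted_nth_mono[OF s(1), of k "i - 1"] i s(2) True show ?thesis by fastforce
      qed
      then have "cnt (take (i - 1) s) i = i - 1"
        using i s(2) cnt_eq_length_iff[of "take (i - 1) s" i] by simp
      then have "i \<le> cnt a i" using c True by (simp add: cnt_def)
      with True show ?thesis by (simp add: s_def)
    next
      case False
      have "i < x" if "x \<in> set (drop i s)" for x
      proof -
        from that obtain k where "k < length s - i" "x = s ! (i + k)"
          by (auto simp: in_set_conv_nth)
        with sorted_nth_mono[OF s(1), of "i - 1" "i + k"] i False show ?thesis by fastforce
      qed
      then have "filter (\<lambda>x. x \<le> i) (drop i s) = []"
        by (auto simp: filter_empty_conv not_le)
      then have "cnt a i \<le> i - 1"
        using c False cnt_le_length[of "take (i - 1) s" i] s(2) i by (simp add: cnt_def)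
      with False i show ?thesis by (simp add: s_def)
    qed
  qed
  have "set a \<subseteq> {1..length a}" if "0 \<notin> set a" "\<forall>i\<le>length a. i \<le> cnt a i"
  proof
    fix x assume x: "x \<in> set a"
    from that(2) have "cnt a (length a) = length a" using cnt_le_length[of a "length a"] by force
    with x cnt_eq_length_iff[of a "length a"] have "x \<le> length a" by auto
    moreover have "x \<noteq> 0" using x that(1) by metis
    ultimately show "x \<in> {1..length a}" by simp
  qed
  moreover have "i \<le> cnt a i" if "\<forall>i\<in>{1..length a}. i \<le> cnt a i" "i \<le> length a" for i
    using that by (cases "i = 0") auto
  ultimately show ?thesis
    unfolding parking_function_def using key by (smt (verit) atLeastAtMost_iff not_one_le_zero subset_iff)
qed

lemma parking_function_pos: "parking_function a \<Longrightarrow> 0 \<notin> set a"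
  by (simp add: parking_function_iff)

lemma parking_function_cnt_ge: "parking_function a \<Longrightarrow> i \<le> length a \<Longrightarrow> i \<le> cnt a i"
  by (simp add: parking_function_iff)

lemma parking_function_cnt_length: "parking_function a \<Longrightarrow> cnt a (length a) = length a"
  using parking_function_cnt_ge[of a "length a"] cnt_le_length[of a "length a"] by simp

lemma parking_function_Nil [simp]: "parking_function []"
  by (simp add: parking_function_iff)

lemma breakpoints_eq: "breakpoints a = {b. b \<le> length a \<and> cnt a b = b}"
  by (simp add: breakpoints_def card_le_eq_cnt)

lemma finite_breakpoints [simp]: "finite (breakpoints a)"
  by (rule finite_subset[of _ "{..length a}"]) (auto simp: breakpoints_def)

section \<open>The first defect, and the amount by which a letter is lowered\<close>

lemma park_defect_cnt: "cnt w (park_defect w) < park_defect w"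
  using park_defect(2)[of w] by (simp add: card_le_eq_cnt)

lemma park_defect_minimal: "y < park_defect w \<Longrightarrow> y \<le> cnt w y"
  using not_less_Least[of y "\<lambda>i. 1 \<le> i \<and> card {j. j < length w \<and> w ! j \<le> i} < i"]
  by (cases "y = 0") (auto simp: park_defect_def card_le_eq_cnt)

lemma park_defect_eq_iff:
  assumes "0 \<notin> set w"
  shows "park_defect w = length w + 1 \<longleftrightarrow> parking_function w"
proof
  assume "park_defect w = length w + 1"
  then have "\<forall>i\<le>length w. i \<le> cnt w i" using park_defect_minimal[of _ w] by simp
  with assms show "parking_function w" by (simp add: parking_function_iff)
next
  assume "parking_function w"
  with park_defect_cnt[of w] have "\<not> park_defect w \<le> length w"
    by (auto simp: parking_function_iff not_less dest!: spec[of _ "park_defect w"])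
  with park_defect(3)[of w] show "park_defect w = length w + 1" by simp
qed

text \<open>
  A letter greater than \<open>y\<close> must be lowered by at least \<open>y - cnt w y\<close> (truncated subtraction), since
  the letters up to \<open>y\<close> can fill only \<open>cnt w y\<close> spots. Parkization lowers a letter by the largest of
  these forced amounts.
\<close>

definition gap :: "nat list \<Rightarrow> nat \<Rightarrow> nat" where
  "gap w y = Max ((\<lambda>j. j - cnt w j) ` {..y})"

definition park_letter :: "nat list \<Rightarrow> nat \<Rightarrow> nat" where
  "park_letter w x = x - gap w (x - 1)"

text \<open>Describing \<open>gap\<close> by its upper bounds replaces the maximum and the truncated
  subtraction by linear inequalities. Formulas for gaps are then proved by showing that both sides
  have the same upper bounds.\<close>

lemma gap_le_iff: "gap w y \<le> b \<longleftrightarrow> (\<forall>j\<le>y. j \<le> b + cnt w j)"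
  unfolding gap_def by (subst Max_le_iff) (auto simp: le_diff_conv)

lemma gap_leD: "j \<le> y \<Longrightarrow> j \<le> gap w y + cnt w j"
  using gap_le_iff[of w y "gap w y"] by simp

lemma gap_le: "gap w y \<le> y"
  by (auto simp: gap_le_iff)

lemma gap_cong: "(\<And>j. j \<le> y \<Longrightarrow> cnt v j = cnt w j) \<Longrightarrow> gap v y = gap w y"
  unfolding gap_def by (rule arg_cong[of _ _ Max]) auto

lemma park_letter_pos: "0 < x \<Longrightarrow> 0 < park_letter w x"
  using gap_le[of w "x - 1"] by (simp add: park_letter_def)

lemma park_letter_parking_function:
  assumes "parking_function w" "x \<in> set w"
  shows "park_letter w x = x"
proof -
  have "x \<le> length w"
    using assms parking_function_cnt_length[of w] by (auto simp: cnt_eq_length_iff)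
  then have "gap w (x - 1) \<le> 0"
    using assms by (subst gap_le_iff) (auto simp: parking_function_iff)
  then show ?thesis by (simp add: park_letter_def)
qed

definition shrink :: "nat \<Rightarrow> nat \<Rightarrow> nat" where
  "shrink d x = (if x > d then x - 1 else x)"

lemma cnt_shrink: "cnt (map (shrink d) v) j = (if j < d then cnt v j else cnt v (Suc j))"
  by (auto simp: cnt_def filter_map o_def shrink_def intro!: arg_cong[of _ _ length] filter_cong)

text \<open>
  The hypothesis on \<open>d\<close> holds at the first defect of a word and is inherited by all its subwords,
  whose own first defects may well be elsewhere.
\<close>

lemma park_letter_shrink:
  assumes pos: "0 \<notin> set v" and d: "1 \<le> d"
    and C: "\<And>y. y < d \<Longrightarrow> y + cnt v d + 1 \<le> d + cnt v y" and x: "x \<in> set v"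
  shows "park_letter (map (shrink d) v) (shrink d x) = park_letter v x"
proof -
  let ?v = "map (shrink d) v"
  have x0: "x \<noteq> 0" using x pos by metis
  have c0: "cnt v 0 = 0" using pos by (metis cnt_def filter_False le_zero_eq list.size(3))
  \<comment> \<open>By \<open>C\<close> at \<open>d - 1\<close> the count does not grow from
    \<open>d - 1\<close> to \<open>d\<close>, so no letter equals \<open>d\<close>.\<close>
  have "x \<noteq> d"
  proof
    assume xd: "x = d"
    from C[of "d - 1"] d have "cnt v d \<le> cnt v (d - 1)" by simp
    then show False using cnt_strict_mono[OF x, of "d - 1"] xd d by simp
  qed
  then consider "x < d" | "d < x" by linarith
  then show ?thesis
  proof cases
    case 1
    then have "gap ?v (x - 1) = gap v (x - 1)" by (intro gap_cong) (auto simp: cnt_shrink)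
    with 1 show ?thesis by (simp add: park_letter_def shrink_def)
  next
    case 2
    \<comment> \<open>A letter above \<open>d\<close> loses exactly one from its gap, which
      compensates its own lowering by one. The lowered letter is \<open>x - 1\<close>, hence its gap
      is taken at \<open>x - 2\<close>.\<close>
    have "gap v (x - 1) \<le> b \<longleftrightarrow> gap ?v (x - 2) + 1 \<le> b" for b
    proof
      assume "gap v (x - 1) \<le> b"
      then have b: "\<And>j. j \<le> x - 1 \<Longrightarrow> j \<le> b + cnt v j" by (simp add: gap_le_iff)
      have db: "d \<le> b + cnt v d" using b[of d] 2 by simp
      \<comment> \<open>\<open>C\<close> at 0 gives \<open>cnt v d < d\<close>, so the amount forced
        at \<open>d\<close> is at least one.\<close>
      have b1: "1 \<le> b" using C[of 0] d c0 db by simp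
      have "gap ?v (x - 2) \<le> b - 1" unfolding gap_le_iff
      proof (intro allI impI)
        fix j assume j: "j \<le> x - 2"
        \<comment> \<open>Below \<open>d\<close> the strict record at \<open>d\<close> leaves one
          unit to spare. From \<open>d\<close> on, \<open>cnt ?v j\<close> is
          \<open>cnt v (Suc j)\<close>, and the bound at \<open>Suc j\<close> applies.\<close>
        have "Suc j \<le> x - 1" using j 2 d by linarith
        then show "j \<le> b - 1 + cnt ?v j"
          using C[of j] db b1 b[of "Suc j"] j 2 by (cases "j < d") (auto simp: cnt_shrink)
      qed
      with b1 show "gap ?v (x - 2) + 1 \<le> b" by simp
    next
      assume "gap ?v (x - 2) + 1 \<le> b"
      then have b1: "1 \<le> b" and "gap ?v (x - 2) \<le> b - 1" by auto
      then have b: "\<And>j. j \<le> x - 2 \<Longrightarrow> j \<le> b - 1 + cnt ?v j" by (simp add: gap_le_iff)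
      show "gap v (x - 1) \<le> b" unfolding gap_le_iff
      proof (intro allI impI)
        fix j assume j: "j \<le> x - 1"
        consider "j < d" | "j = d" | "d < j" by linarith
        then show "j \<le> b + cnt v j"
        proof cases
          case 1
          moreover have "j \<le> x - 2" using 1 \<open>d < x\<close> by linarith
          ultimately show ?thesis using b[of j] by (auto simp: cnt_shrink)
        next
          case 2
          moreover have "d - 1 \<le> x - 2" using \<open>d < x\<close> by linarith
          ultimately show ?thesis
            using b[of "d - 1"] cnt_mono[of "d - 1" d v] b1 d by (auto simp: cnt_shrink)
        next
          case 3
          then have "j - 1 \<le> x - 2" "\<not> j - 1 < d" "Suc (j - 1) = j" using j by linarith+
          then show ?thesis using b[of "j - 1"] b1 by (simp add: cnt_shrink)
        qed
      qed
    qed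
    then have "gap v (x - 1) = gap ?v (x - 2) + 1" by (meson dual_order.antisym order_refl)
    with 2 show ?thesis by (simp add: park_letter_def shrink_def numeral_2_eq_2)
  qed
qed

section \<open>Parkization in closed form and on subwords\<close>

lemma park_step: "\<not> park_defect w = length w + 1 \<Longrightarrow> park w = park (map (shrink (park_defect w)) w)"
  by (subst park.simps) (simp add: shrink_def[abs_def])

lemma zero_notin_shrink: "1 \<le> d \<Longrightarrow> 0 \<notin> set w \<Longrightarrow> 0 \<notin> set (map (shrink d) w)"
  by (auto simp: shrink_def)

text \<open>Before the first defect \<open>d\<close> of \<open>w\<close> every \<open>y\<close>
  satisfies \<open>y \<le> cnt w y\<close>, whereas \<open>cnt w d < d\<close>. So \<open>w\<close>
  has a strict record at \<open>d\<close>, and \<open>cnt_submset\<close> hands it down to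
  \<open>v\<close>.\<close>

lemma park_defect_submset:
  assumes "mset v \<subseteq># mset w" "y < park_defect w"
  shows "y + cnt v (park_defect w) + 1 \<le> park_defect w + cnt v y"
  using cnt_submset[OF assms(1), of y "park_defect w"] park_defect_minimal[OF assms(2)]
    park_defect_cnt[of w] assms(2) by linarith

lemma park_letter_submset:
  assumes "0 \<notin> set w" "mset v \<subseteq># mset w"
  shows "map (park_letter (map (shrink (park_defect w)) v)) (map (shrink (park_defect w)) v) = map (park_letter v) v"
proof -
  have "0 \<notin> set v" using assms by (metis mset_subset_eqD set_mset_mset)
  then show ?thesis
    using park_letter_shrink[of v "park_defect w"] park_defect_submset[OF assms(2)]
      park_defect(1)[of w] by simp
qed

lemma park_parking_function: "parking_function w \<Longrightarrow> park w = w"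
  using park_defect_eq_iff[of w] parking_function_pos[of w] by (subst park.simps) simp

text \<open>Each lowering step leaves the right-hand side invariant, by
  \<open>park_letter_submset\<close> with \<open>v = w\<close>, and the right-hand side is the word
  itself once a parking function is reached.\<close>

theorem park_eq: "0 \<notin> set w \<Longrightarrow> park w = map (park_letter w) w"
proof (induction w rule: park.induct)
  case (1 w)
  let ?w = "map (shrink (park_defect w)) w"
  show ?case
  proof (cases "parking_function w")
    case True
    then have "map (park_letter w) w = w" by (simp add: park_letter_parking_function map_idI)
    then show ?thesis by (simp add: park_parking_function True)
  next
    case False
    then have d: "park_defect w \<noteq> length w + 1" using park_defect_eq_iff[OF 1(2)] by simp
    have "park w = map (park_letter ?w) ?w"
      using park_step[OF d] 1(1)[OF d] zero_notin_shrink[OF park_defect(1) 1(2)]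
      by (simp add: shrink_def[abs_def])
    then show ?thesis using park_letter_submset[OF 1(2), of w] by simp
  qed
qed

lemma parking_function_park: "0 \<notin> set w \<Longrightarrow> parking_function (park w)"
proof (induction w rule: park.induct)
  case (1 w)
  show ?case
  proof (cases "parking_function w")
    case False
    then have d: "park_defect w \<noteq> length w + 1" using park_defect_eq_iff[OF 1(2)] by simp
    show ?thesis
      using park_step[OF d] 1(1)[OF d] zero_notin_shrink[OF park_defect(1) 1(2)]
      by (simp add: shrink_def[abs_def])
  qed (simp add: park_parking_function)
qed

lemma length_park [simp]: "length (park w) = length w"
  by (induction w rule: park.induct) (subst park.simps, simp)

text \<open>The induction follows the lowering steps of \<open>w\<close>: a step changes neither the
  values that \<open>park_letter w\<close> assigns to the letters of \<open>v\<close> nor, by the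
  letterwise formula, \<open>park v\<close>.\<close>

theorem park_map_park_letter:
  assumes "0 \<notin> set w" "mset v \<subseteq># mset w"
  shows "park (map (park_letter w) v) = park v"
  using assms
proof (induction w arbitrary: v rule: park.induct)
  case (1 w)
  let ?w = "map (shrink (park_defect w)) w"
  let ?v = "map (shrink (park_defect w)) v"
  have sub: "set v \<subseteq> set w" using 1(3) by (metis set_mset_mono set_mset_mset)
  have v0: "0 \<notin> set v" using 1(2) sub by blast
  show ?case
  proof (cases "parking_function w")
    case True
    then have "map (park_letter w) v = v"
      using sub by (intro map_idI) (auto simp: park_letter_parking_function)
    then show ?thesis by simp
  next
    case False
    then have d: "park_defect w \<noteq> length w + 1" using park_defect_eq_iff[OF 1(2)] by simp
    have "map (park_letter w) v = map (park_letter ?w) ?v"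
      using park_letter_submset[OF 1(2), of w] sub by auto
    also have "park \<dots> = park ?v"
      using 1(1)[OF d, of ?v] zero_notin_shrink[OF park_defect(1) 1(2)] 1(3)
      by (simp add: shrink_def[abs_def] image_mset_subseteq_mono)
    also have "\<dots> = park v"
      using park_letter_submset[OF 1(2,3)] v0 zero_notin_shrink[OF park_defect(1), of v w]
      by (simp add: park_eq del: map_map)
    finally show ?thesis .
  qed
qed

section \<open>Parkization, breakpoints and convolution of colored words\<close>

lemma cnt_zero: "0 \<notin> set w \<Longrightarrow> cnt w 0 = 0"
  by (metis cnt_def filter_False le_zero_eq list.size(3))

lemma cnt_filter_le: "cnt (filter (\<lambda>x. x \<le> i) w) y = cnt w (min i y)"
  by (auto simp: cnt_def intro!: arg_cong[of _ _ length] filter_cong)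

lemma cnt_filter_gt: "cnt (map (\<lambda>x. x - i) (filter (\<lambda>x. i < x) w)) y + cnt w i = cnt w (i + y)"
  by (induction w) (auto simp: cnt_def)

text \<open>
  A condition under which parkization sends exactly the letters up to \<open>i\<close> to letters up to \<open>cnt w i\<close>.
  Every subword of a parking function satisfies it at each breakpoint \<open>i\<close> of the latter.
\<close>

definition tight :: "nat list \<Rightarrow> nat \<Rightarrow> bool" where
  "tight w i \<longleftrightarrow> (\<forall>y\<le>i. y + cnt w i \<le> i + cnt w y)"

text \<open>In \<open>a\<close> the difference of \<open>y\<close> and \<open>cnt a y\<close> is at
  most 0 up to the length, and it is 0 at the breakpoint \<open>i\<close>. By
  \<open>cnt_submset\<close> it stays maximal at \<open>i\<close>, among all
  \<open>y \<le> i\<close>, for the subword.\<close>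

lemma tight_submset:
  assumes "parking_function a" "i \<in> breakpoints a" "mset v \<subseteq># mset a"
  shows "tight v i"
  unfolding tight_def
proof (intro allI impI)
  fix y assume "y \<le> i"
  then show "y + cnt v i \<le> i + cnt v y"
    using cnt_submset[OF assms(3), of y i] parking_function_cnt_ge[OF assms(1), of y] assms(2)
    by (auto simp: breakpoints_eq)
qed

lemma tight_cnt_le: "tight w i \<Longrightarrow> 0 \<notin> set w \<Longrightarrow> cnt w i \<le> i"
  using cnt_zero[of w] by (auto simp: tight_def dest!: spec[of _ 0])

lemma park_letter_low: "x \<le> i \<Longrightarrow> park_letter (filter (\<lambda>x. x \<le> i) w) x = park_letter w x"
  unfolding park_letter_def by (intro arg_cong[of _ _ "(-) x"] gap_cong) (simp add: cnt_filter_le min.absorb2)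

text \<open>The gap brings \<open>x\<close> down to at most \<open>cnt w (x - 1) + 1\<close>, and as
  \<open>x\<close> itself occurs, this is at most \<open>cnt w x\<close>.\<close>

lemma park_letter_low_le:
  assumes "x \<in> set w" "0 < x" "x \<le> i"
  shows "park_letter w x \<le> cnt w i"
  using gap_leD[of "x - 1" "x - 1" w] cnt_strict_mono[OF assms(1), of "x - 1"] assms(2)
    cnt_mono[OF assms(3), of w]
  unfolding park_letter_def by simp

text \<open>Tightness makes \<open>i - cnt w i\<close> the largest amount forced up to
  \<open>i\<close>. Beyond \<open>i\<close>, the integer difference at \<open>i + j\<close> is
  \<open>i - cnt w i\<close> plus the difference at \<open>j\<close> for the shifted large letters,
  so the gaps add.\<close>

lemma park_letter_high:
  assumes t: "tight w i" and w: "0 \<notin> set w" and x: "i < x"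
  shows "park_letter w x = cnt w i + park_letter (map (\<lambda>x. x - i) (filter (\<lambda>x. i < x) w)) (x - i)"
proof -
  let ?h = "map (\<lambda>x. x - i) (filter (\<lambda>x. i < x) w)"
  let ?k = "cnt w i"
  have k: "?k \<le> i" using t w by (rule tight_cnt_le)
  have "gap w (x - 1) \<le> b \<longleftrightarrow> (i - ?k) + gap ?h (x - i - 1) \<le> b" for b
  proof
    assume "gap w (x - 1) \<le> b"
    then have b: "\<And>j. j \<le> x - 1 \<Longrightarrow> j \<le> b + cnt w j" by (simp add: gap_le_iff)
    have ib: "i \<le> b + ?k" using b[of i] x by simp
    have "gap ?h (x - i - 1) \<le> b - (i - ?k)" unfolding gap_le_iff
    proof (intro allI impI)
      fix j assume "j \<le> x - i - 1"
      then have "i + j \<le> b + cnt w (i + j)" using b[of "i + j"] x by linarith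
      then show "j \<le> b - (i - ?k) + cnt ?h j" using cnt_filter_gt[of i w j] k ib by linarith
    qed
    then show "(i - ?k) + gap ?h (x - i - 1) \<le> b" using ib by linarith
  next
    assume h: "(i - ?k) + gap ?h (x - i - 1) \<le> b"
    show "gap w (x - 1) \<le> b" unfolding gap_le_iff
    proof (intro allI impI)
      fix j assume j: "j \<le> x - 1"
      show "j \<le> b + cnt w j"
      proof (cases "j \<le> i")
        case True
        then have "j + ?k \<le> i + cnt w j" using t by (simp add: tight_def)
        then show ?thesis using h by linarith
      next
        case False
        then have "j - i \<le> gap ?h (x - i - 1) + cnt ?h (j - i)" using j by (intro gap_leD) auto
        then show ?thesis using cnt_filter_gt[of i w "j - i"] k h False by simp
      qed
    qed
  qed
  then have "gap w (x - 1) = (i - ?k) + gap ?h (x - i - 1)" by (meson dual_order.antisym order_refl)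
  then show ?thesis using gap_le[of ?h "x - i - 1"] x k unfolding park_letter_def by linarith
qed

text \<open>A colored word as a list of letters paired with their colors.\<close>

type_synonym letters = "(nat \<times> nat) list"

section \<open>Cutting and parkizing words of colored letters\<close>

definition low :: "nat \<Rightarrow> letters \<Rightarrow> letters" where
  "low i z = filter (\<lambda>p. fst p \<le> i) z"

text \<open>If \<open>i\<close> is a breakpoint of a parking function, subtracting \<open>i\<close>
  already parkizes the large letters; \<open>crestrict_high\<close> proves this.\<close>

definition high :: "nat \<Rightarrow> letters \<Rightarrow> letters" where
  "high i z = map (apfst (\<lambda>x. x - i)) (filter (\<lambda>p. i < fst p) z)"

text \<open>The letterwise formula carries the colors along without following the recursion;
  \<open>vals_parkize\<close> links it to \<open>park\<close> on words of positive letters.\<close>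

definition parkize :: "letters \<Rightarrow> letters" where
  "parkize z = map (apfst (park_letter (map fst z))) z"

abbreviation vals :: "letters \<Rightarrow> nat list" where
  "vals z \<equiv> map fst z"

abbreviation bps :: "letters \<Rightarrow> nat set" where
  "bps z \<equiv> breakpoints (vals z)"

lemma vals_low: "vals (low i z) = filter (\<lambda>x. x \<le> i) (vals z)"
  by (simp add: low_def filter_map o_def)

lemma vals_high: "vals (high i z) = map (\<lambda>x. x - i) (filter (\<lambda>x. i < x) (vals z))"
  by (simp add: high_def filter_map o_def)

lemma low_append: "low i (z @ z') = low i z @ low i z'"
  by (simp add: low_def)

lemma high_append: "high i (z @ z') = high i z @ high i z'"
  by (simp add: high_def)

lemma length_low [simp]: "length (low i z) = cnt (vals z) i"
  by (simp add: low_def cnt_def filter_map o_def)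

lemma length_low_high: "length (low i z) + length (high i z) = length z"
  using sum_length_filter_compl[of "\<lambda>p. fst p \<le> i" z] by (simp add: low_def high_def not_le del: length_low)

lemma length_high [simp]: "length (high i z) = length z - cnt (vals z) i"
  using length_low_high[of i z] by simp

lemma cnt_high: "cnt (vals (high i z)) y + cnt (vals z) i = cnt (vals z) (i + y)"
  unfolding vals_high by (rule cnt_filter_gt)

lemma cnt_low: "cnt (vals (low i z)) y = cnt (vals z) (min i y)"
  unfolding vals_low by (rule cnt_filter_le)

lemma low_low: "low j (low i z) = low (min i j) z"
  by (simp add: low_def)

lemma high_high: "high j (high i z) = high (i + j) z"
  by (auto simp: high_def filter_map o_def less_diff_conv add.commute intro!: map_cong filter_cong)

lemma low_high: "low j (high i z) = high i (low (i + j) z)"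
  by (auto simp: high_def low_def filter_map o_def le_diff_conv add.commute intro!: map_cong filter_cong)

lemma length_parkize [simp]: "length (parkize z) = length z"
  by (simp add: parkize_def)

lemma map_snd_parkize [simp]: "map snd (parkize z) = map snd z"
  by (simp add: parkize_def)

lemma vals_parkize: "0 \<notin> set (vals z) \<Longrightarrow> vals (parkize z) = park (vals z)"
  by (simp add: parkize_def park_eq)

lemma letters_eqI: "vals z = vals z' \<Longrightarrow> map snd z = map snd z' \<Longrightarrow> z = z'"
  by (metis zip_map_fst_snd)

lemma parkize_parking_function: "parking_function (vals z) \<Longrightarrow> parkize z = z"
  by (rule letters_eqI) (simp_all add: vals_parkize parking_function_pos park_parking_function del: set_map)

lemma parking_function_parkize: "0 \<notin> set (vals z) \<Longrightarrow> parking_function (vals (parkize z))"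
  by (simp add: vals_parkize parking_function_park del: set_map)

lemma parkize_sub:
  assumes "0 \<notin> set (vals w)" "mset v \<subseteq># mset w"
  shows "parkize (map (apfst (park_letter (vals w))) v) = parkize v"
proof (rule letters_eqI)
  let ?v = "map (apfst (park_letter (vals w))) v"
  have sub: "mset (vals v) \<subseteq># mset (vals w)" using assms(2) by (simp add: image_mset_subseteq_mono)
  have v0: "0 \<notin> set (vals v)" using sub assms(1) by (metis mset_subset_eqD set_mset_mset)
  have nz: "park_letter (vals w) (fst p) \<noteq> 0" if "p \<in> set v" for p
    using v0 that park_letter_pos[of "fst p" "vals w"] by (metis gr0I image_eqI less_irrefl set_map)
  have "0 \<notin> set (vals ?v)"
  proof
    assume "0 \<in> set (vals ?v)"
    then obtain p where "p \<in> set v" "park_letter (vals w) (fst p) = 0" by auto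
    then show False using nz[of p] by blast
  qed
  then have "vals (parkize ?v) = park (map (park_letter (vals w)) (vals v))"
    by (simp add: vals_parkize del: set_map)
  also have "\<dots> = vals (parkize v)"
    using park_map_park_letter[OF assms(1) sub] v0 by (simp add: vals_parkize del: set_map map_map)
  finally show "vals (parkize ?v) = vals (parkize v)" .
  show "map snd (parkize ?v) = map snd (parkize v)" by simp
qed

text \<open>A large letter becomes \<open>cnt (vals z) i\<close> plus a positive number, so small
  and large letters stay apart while the cut moves from \<open>i\<close> to the number of small
  letters.\<close>

lemma park_letter_le_iff:
  assumes "tight (vals z) i" "0 \<notin> set (vals z)" "x \<in> set (vals z)"
  shows "park_letter (vals z) x \<le> cnt (vals z) i \<longleftrightarrow> x \<le> i"
proof (cases "x \<le> i")
  case True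
  then show ?thesis using park_letter_low_le[OF assms(3), of i] assms(2,3) by (metis gr0I)
next
  case False
  then show ?thesis
    using park_letter_high[OF assms(1,2), of x] park_letter_pos[of "x - i"] by simp
qed

text \<open>Both sides select the same positions, and the new value of a letter depends only on the
  counts below it, which \<open>low i z\<close> retains.\<close>

lemma low_parkize:
  assumes "tight (vals z) i" "0 \<notin> set (vals z)"
  shows "low (cnt (vals z) i) (parkize z) = parkize (low i z)"
proof -
  have "filter (\<lambda>p. park_letter (vals z) (fst p) \<le> cnt (vals z) i) z = low i z"
    unfolding low_def using park_letter_le_iff[OF assms] by (intro filter_cong) auto
  then have "low (cnt (vals z) i) (parkize z) = map (apfst (park_letter (vals z))) (low i z)"
    by (simp add: low_def parkize_def filter_map o_def)
  also have "\<dots> = parkize (low i z)"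
    unfolding parkize_def vals_low
    by (rule map_cong[OF refl]) (auto simp: low_def park_letter_low)
  finally show ?thesis .
qed

text \<open>The summand \<open>cnt (vals z) i\<close> in \<open>park_letter_high\<close> is exactly
  what \<open>high\<close> subtracts.\<close>

lemma high_parkize:
  assumes "tight (vals z) i" "0 \<notin> set (vals z)"
  shows "high (cnt (vals z) i) (parkize z) = parkize (high i z)"
proof -
  have "filter (\<lambda>p. cnt (vals z) i < park_letter (vals z) (fst p)) z = filter (\<lambda>p. i < fst p) z"
    using park_letter_le_iff[OF assms] by (intro filter_cong) (auto simp flip: not_le)
  then have "high (cnt (vals z) i) (parkize z) =
      map (apfst (\<lambda>x. park_letter (vals z) x - cnt (vals z) i)) (filter (\<lambda>p. i < fst p) z)"
    by (simp add: high_def parkize_def filter_map o_def apfst_compose)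
  also have "\<dots> = map (apfst (\<lambda>x. park_letter (vals (high i z)) (x - i))) (filter (\<lambda>p. i < fst p) z)"
    using park_letter_high[OF assms] by (intro map_cong) (auto simp: vals_high apfst_def map_prod_def)
  also have "\<dots> = parkize (high i z)"
    by (simp add: parkize_def high_def o_def apfst_compose)
  finally show ?thesis .
qed

lemma le_pattern_parkize:
  assumes "tight (vals z) i" "0 \<notin> set (vals z)"
  shows "map (\<lambda>p. fst p \<le> cnt (vals z) i) (parkize z) = map (\<lambda>p. fst p \<le> i) z"
  using park_letter_le_iff[OF assms] by (auto simp: parkize_def)

lemma bps_eq: "bps z = {b. b \<le> length z \<and> cnt (vals z) b = b}"
  by (simp add: breakpoints_eq)

lemma bps_low: "i \<in> bps z \<Longrightarrow> bps (low i z) = {j \<in> bps z. j \<le> i}"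
  by (auto simp: bps_eq cnt_low min_def)

lemma bps_high: "i \<in> bps z \<Longrightarrow> bps (high i z) = {j. i + j \<in> bps z}"
  using cnt_high[of i z] by (auto simp: bps_eq) (metis add.commute add_left_cancel)+

text \<open>As \<open>i\<close> letters lie up to \<open>i\<close>, the counting criterion for
  \<open>z\<close> at \<open>y > i\<close> is the criterion for \<open>high i z\<close> at
  \<open>y - i\<close>. The converse serves to assemble a parking function from two pieces.\<close>

lemma parking_function_low_high_iff:
  assumes "cnt (vals z) i = i"
  shows "parking_function (vals z) \<longleftrightarrow> parking_function (vals (low i z)) \<and> parking_function (vals (high i z))"
proof -
  have i: "i \<le> length z" using cnt_le_length[of "vals z" i] assms by simp
  have "0 \<notin> set (vals z) \<longleftrightarrow> 0 \<notin> set (vals (low i z))" by (auto simp: low_def)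
  moreover have "0 \<notin> set (vals (high i z))" by (auto simp: high_def)
  moreover have "(\<forall>y\<le>length z. y \<le> cnt (vals z) y) \<longleftrightarrow>
    (\<forall>y\<le>i. y \<le> cnt (vals (low i z)) y) \<and> (\<forall>y\<le>length z - i. y \<le> cnt (vals (high i z)) y)"
    (is "?A \<longleftrightarrow> ?B \<and> ?C")
  proof (intro iffI conjI allI impI)
    fix y assume "?A" "y \<le> i"
    then show "y \<le> cnt (vals (low i z)) y" using i by (simp add: cnt_low min_def)
  next
    fix y assume a: "?A" "y \<le> length z - i"
    then have "i + y \<le> cnt (vals z) (i + y)" using i by simp
    then show "y \<le> cnt (vals (high i z)) y" using cnt_high[of i z y] assms by simp
  next
    fix y assume a: "?B \<and> ?C" "y \<le> length z"
    show "y \<le> cnt (vals z) y"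
    proof (cases "y \<le> i")
      case True
      then have "y \<le> cnt (vals (low i z)) y" using a by blast
      then show ?thesis using True by (simp add: cnt_low)
    next
      case False
      then have "y - i \<le> cnt (vals (high i z)) (y - i)" using a by simp
      then show ?thesis using cnt_high[of i z "y - i"] assms False by simp
    qed
  qed
  ultimately show ?thesis by (simp add: parking_function_iff assms del: set_map)
qed

section \<open>Shuffles, and the bijection behind multiplicativity of the coproduct\<close>

fun merge :: "bool list \<Rightarrow> 'a list \<Rightarrow> 'a list \<Rightarrow> 'a list" where
  "merge [] xs ys = []"
| "merge (True # bs) xs ys = hd xs # merge bs (tl xs) ys"
| "merge (False # bs) xs ys = hd ys # merge bs xs (tl ys)"

lemma merge_filter: "merge (map P z) (filter P z) (filter (\<lambda>x. \<not> P x) z) = z"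
proof (induction z)
  case (Cons x z)
  then show ?case by (cases "P x") auto
qed simp

text \<open>Matching the lengths with the pattern keeps \<open>merge\<close> from reaching the
  unspecified \<open>hd []\<close>.\<close>

lemma filter_merge:
  assumes "length (filter id bs) = length xs" "length (filter Not bs) = length ys"
    "\<forall>x\<in>set xs. P x" "\<forall>y\<in>set ys. \<not> P y"
  shows "filter P (merge bs xs ys) = xs" "filter (\<lambda>x. \<not> P x) (merge bs xs ys) = ys"
    "map P (merge bs xs ys) = bs"
  using assms
  by (induction bs xs ys rule: merge.induct) (auto simp: Suc_length_conv)

text \<open>Since \<open>parkize\<close> keeps colors, the last two conditions force the colors of
  \<open>z\<close> to be those of \<open>z1\<close> followed by those of \<open>z2\<close>.\<close>

definition conv :: "letters \<Rightarrow> letters \<Rightarrow> letters set" where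
  "conv z1 z2 = {z. parking_function (vals z) \<and> length z = length z1 + length z2 \<and>
     parkize (take (length z1) z) = z1 \<and> parkize (drop (length z1) z) = z2}"

lemma merge_low_high:
  "merge (map (\<lambda>p. fst p \<le> i) z) (low i z) (map (apfst (\<lambda>x. x + i)) (high i z)) = z"
proof -
  have "map (apfst (\<lambda>x. x + i)) (high i z) = filter (\<lambda>p. \<not> fst p \<le> i) z"
    by (auto simp: high_def not_le o_def apfst_def map_prod_def intro!: map_idI)
  then show ?thesis by (simp add: low_def merge_filter)
qed

text \<open>
  Inverse of cutting \<open>z\<close> at a breakpoint: the letters that parkize to \<open>z1\<close>, \<open>z2\<close> are small or large
  exactly where those of \<open>z1\<close>, \<open>z2\<close> are, with respect to the breakpoints \<open>i1\<close>, \<open>i2\<close>.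
\<close>

definition combine :: "letters \<Rightarrow> letters \<Rightarrow> nat \<Rightarrow> nat \<Rightarrow> letters \<Rightarrow> letters \<Rightarrow> letters" where
  "combine z1 z2 i1 i2 b c = merge (map (\<lambda>p. fst p \<le> i1) z1 @ map (\<lambda>p. fst p \<le> i2) z2) b
     (map (apfst (\<lambda>x. x + (i1 + i2))) c)"

lemma mset_take_subset: "mset (take n z) \<subseteq># mset z"
  by (metis append_take_drop_id mset_append mset_subset_eq_add_left)

lemma mset_drop_subset: "mset (drop n z) \<subseteq># mset z"
  by (metis append_take_drop_id mset_append mset_subset_eq_add_right)

lemma conv_appendI:
  "parking_function (vals (v @ w)) \<Longrightarrow> v @ w \<in> conv (parkize v) (parkize w)"
  by (simp add: conv_def)

lemma convE:
  assumes "z \<in> conv z1 z2"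
  obtains v w where "z = v @ w" "z1 = parkize v" "z2 = parkize w" "parking_function (vals (v @ w))"
proof (rule that)
  show "z = take (length z1) z @ drop (length z1) z" by simp
qed (use assms in \<open>auto simp: conv_def\<close>)

lemma tight_append:
  assumes "parking_function (vals (v @ w))" "i \<in> bps (v @ w)"
  shows "tight (vals v) i" "tight (vals w) i" "0 \<notin> set (vals v)" "0 \<notin> set (vals w)"
  using assms(2) parking_function_pos[OF assms(1)] tight_submset[OF assms(1), of i "vals v"]
    tight_submset[OF assms(1), of i "vals w"] by auto

text \<open>This is the cutting half of the bijection. Both factors are tight at \<open>i\<close>,
  so cutting commutes with parkizing them once the cuts move to \<open>i1\<close> and
  \<open>i2\<close>. The pattern of small and large letters survives too, which lets
  \<open>combine\<close> undo the cut.\<close>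

lemma conv_low_high:
  assumes p: "parking_function (vals (v @ w))" and i: "i \<in> bps (v @ w)"
    and i1: "i1 = cnt (vals v) i" and i2: "i2 = cnt (vals w) i"
  shows "i1 + i2 = i" "i1 \<in> bps (parkize v)" "i2 \<in> bps (parkize w)"
    "low i (v @ w) \<in> conv (low i1 (parkize v)) (low i2 (parkize w))"
    "high i (v @ w) \<in> conv (high i1 (parkize v)) (high i2 (parkize w))"
    "combine (parkize v) (parkize w) i1 i2 (low i (v @ w)) (high i (v @ w)) = v @ w"
proof -
  note t = tight_append[OF p i]
  have ci: "cnt (vals (v @ w)) i = i" using i[unfolded bps_eq] by blast
  then show ii: "i1 + i2 = i" by (simp add: i1 i2 cnt_append)
  note lo = low_parkize[OF t(1,3), folded i1] low_parkize[OF t(2,4), folded i2]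
  note hi = high_parkize[OF t(1,3), folded i1] high_parkize[OF t(2,4), folded i2]
  \<comment> \<open>\<open>low i1 (parkize v)\<close> has as many letters as \<open>low i v\<close>,
    namely \<open>i1\<close>.\<close>
  show "i1 \<in> bps (parkize v)" using arg_cong[OF lo(1), of length] cnt_le_length[of "vals v" i]
    by (simp add: bps_eq i1)
  show "i2 \<in> bps (parkize w)" using arg_cong[OF lo(2), of length] cnt_le_length[of "vals w" i]
    by (simp add: bps_eq i2)
  have q: "parking_function (vals (low i (v @ w)))" "parking_function (vals (high i (v @ w)))"
    using p parking_function_low_high_iff[OF ci] by auto
  show "low i (v @ w) \<in> conv (low i1 (parkize v)) (low i2 (parkize w))"
    using conv_appendI[OF q(1)[unfolded low_append]] by (simp add: lo low_append)
  show "high i (v @ w) \<in> conv (high i1 (parkize v)) (high i2 (parkize w))"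
    using conv_appendI[OF q(2)[unfolded high_append]] by (simp add: hi high_append)
  have "map (\<lambda>p. fst p \<le> i) (v @ w) = map (\<lambda>p. fst p \<le> i1) (parkize v) @ map (\<lambda>p. fst p \<le> i2) (parkize w)"
    using le_pattern_parkize[OF t(1,3)] le_pattern_parkize[OF t(2,4)] by (simp add: i1 i2)
  then show "combine (parkize v) (parkize w) i1 i2 (low i (v @ w)) (high i (v @ w)) = v @ w"
    using merge_low_high[of i "v @ w"] by (simp only: combine_def ii)
qed

lemma letters_low_high_eqI:
  assumes "map (\<lambda>p. fst p \<le> i) v = map (\<lambda>p. fst p \<le> i) w" "low i v = low i w" "high i v = high i w"
  shows "v = w"
  by (metis merge_low_high assms)

text \<open>This is the assembling half of the bijection. The letters of \<open>b\<close> and the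
  shifted ones of \<open>c\<close> are separated by value at \<open>i1 + i2\<close>, so pattern, low
  part and high part can be read off the merged word. Compared within each factor, these three
  determine its parkization by \<open>letters_low_high_eqI\<close>.\<close>

lemma combine_conv:
  assumes p1: "parking_function (vals z1)" and p2: "parking_function (vals z2)"
    and i1: "i1 \<in> bps z1" and i2: "i2 \<in> bps z2"
    and b: "b \<in> conv (low i1 z1) (low i2 z2)" and c: "c \<in> conv (high i1 z1) (high i2 z2)"
    and v: "v = take (length z1) (combine z1 z2 i1 i2 b c)"
    and w: "w = drop (length z1) (combine z1 z2 i1 i2 b c)"
  shows "parking_function (vals (v @ w))" "i1 + i2 \<in> bps (v @ w)"
    "low (i1 + i2) (v @ w) = b" "high (i1 + i2) (v @ w) = c"
    "parkize v = z1" "parkize w = z2" "cnt (vals v) (i1 + i2) = i1" "cnt (vals w) (i1 + i2) = i2"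
proof -
  let ?i = "i1 + i2"
  let ?bs1 = "map (\<lambda>p. fst p \<le> i1) z1" and ?bs2 = "map (\<lambda>p. fst p \<le> i2) z2"
  let ?c = "map (apfst (\<lambda>x. x + ?i)) c"
  have z: "combine z1 z2 i1 i2 b c = v @ w" by (simp add: v w)
  have c1: "cnt (vals z1) i1 = i1" "cnt (vals z2) i2 = i2" using i1 i2 by (auto simp: bps_eq)
  obtain b1 b2 where b12: "b = b1 @ b2" "low i1 z1 = parkize b1" "low i2 z2 = parkize b2"
    and pb: "parking_function (vals b)" using b by (auto elim: convE)
  obtain d1 d2 where d12: "c = d1 @ d2" "high i1 z1 = parkize d1" "high i2 z2 = parkize d2"
    and pc: "parking_function (vals c)" using c by (auto elim: convE)
  have lb: "length b1 = i1" "length b2 = i2"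
    using arg_cong[OF b12(2), of length] arg_cong[OF b12(3), of length] c1 by simp_all
  have ld: "length d1 = length z1 - i1" "length d2 = length z2 - i2"
    using arg_cong[OF d12(2), of length] arg_cong[OF d12(3), of length] c1 by simp_all
  have T: "length (filter id (map (\<lambda>p. fst p \<le> i) y)) = cnt (vals y) i"
     "length (filter Not (map (\<lambda>p. fst p \<le> i) y)) = length y - cnt (vals y) i" for i and y :: letters
    using length_low[of i y] length_high[of i y]
    by (simp_all add: low_def high_def filter_map o_def not_le del: length_low length_high)
  \<comment> \<open>\<open>b\<close> is a parking function of length \<open>i1 + i2\<close>, which
    bounds its letters; those of \<open>c\<close> are positive and are shifted past this
    bound.\<close>
  have fb: "\<forall>p\<in>set b. fst p \<le> ?i"
    using parking_function_cnt_length[OF pb] cnt_eq_length_iff[of "vals b" ?i] lb b12(1) by auto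
  have fc: "\<forall>p\<in>set ?c. \<not> fst p \<le> ?i"
    using parking_function_pos[OF pc] by (force simp: not_le)
  have l1: "length (filter id (?bs1 @ ?bs2)) = length b"
    by (simp only: filter_append length_append T c1 b12(1) lb)
  have l2: "length (filter Not (?bs1 @ ?bs2)) = length ?c"
    by (simp only: filter_append length_append length_map T c1 d12(1) ld)
  note m = filter_merge[OF l1 l2 fb fc, folded combine_def, unfolded z]
  show lo: "low ?i (v @ w) = b" using m(1) by (simp add: low_def)
  have "high ?i (v @ w) = map (apfst (\<lambda>x. x - ?i)) (filter (\<lambda>p. \<not> fst p \<le> ?i) (v @ w))"
    by (simp add: high_def not_le)
  also have "\<dots> = c" unfolding m(2) by (auto simp: apfst_def map_prod_def intro!: map_idI)
  finally show hi: "high ?i (v @ w) = c" .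
  have cv: "cnt (vals (v @ w)) ?i = ?i" using arg_cong[OF lo, of length] lb b12(1) by simp
  show pz: "parking_function (vals (v @ w))"
    unfolding parking_function_low_high_iff[OF cv] lo hi using pb pc by simp
  show i: "?i \<in> bps (v @ w)" using cv cnt_le_length[of "vals (v @ w)" ?i] unfolding bps_eq by simp
  have "length (v @ w) = length z1 + length z2" using arg_cong[OF m(3), of length] by simp
  then have lv: "length v = length z1" by (simp add: v w)
  then have pat: "map (\<lambda>p. fst p \<le> ?i) v = ?bs1" "map (\<lambda>p. fst p \<le> ?i) w = ?bs2"
    using m(3) by (simp_all add: append_eq_append_conv)
  show k: "cnt (vals v) ?i = i1" "cnt (vals w) ?i = i2"
    using T(1)[of ?i v] T(1)[of ?i w] unfolding pat T(1) c1 by simp_all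
  note t = tight_append[OF pz i]
  \<comment> \<open>Equal lengths of the first factors make the two concatenations split at the same
    place.\<close>
  have lo2: "low ?i v = b1" "low ?i w = b2"
    using lo lb b12(1) k by (simp_all add: low_append append_eq_append_conv)
  have hi2: "high ?i v = d1" "high ?i w = d2"
    using hi ld d12(1) k lv by (simp_all add: high_append append_eq_append_conv)
  show "parkize v = z1"
    using letters_low_high_eqI[of i1 "parkize v" z1] le_pattern_parkize[OF t(1,3)]
      low_parkize[OF t(1,3)] high_parkize[OF t(1,3)] by (simp add: k lo2 hi2 b12 d12 pat)
  show "parkize w = z2"
    using letters_low_high_eqI[of i2 "parkize w" z2] le_pattern_parkize[OF t(2,4)]
      low_parkize[OF t(2,4)] high_parkize[OF t(2,4)] by (simp add: k lo2 hi2 b12 d12 pat)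
qed

lemma map_snd_conv: "z \<in> conv z1 z2 \<Longrightarrow> map snd z = map snd z1 @ map snd z2"
  by (auto elim!: convE)

text \<open>The colors are fixed and the values bounded by the length. Turning the nested sums over
  \<open>conv\<close> into sums over pairs requires this finiteness.\<close>

lemma finite_conv [simp]: "finite (conv z1 z2)"
proof -
  let ?n = "length z1 + length z2"
  have "conv z1 z2 \<subseteq> (\<lambda>a. zip a (map snd z1 @ map snd z2)) ` {a. set a \<subseteq> {..?n} \<and> length a = ?n}"
  proof
    fix z assume z: "z \<in> conv z1 z2"
    then have "parking_function (vals z)" "length z = ?n" by (auto simp: conv_def)
    then have "vals z \<in> {a. set a \<subseteq> {..?n} \<and> length a = ?n}"
      using parking_function_cnt_length[of "vals z"] cnt_eq_length_iff[of "vals z" ?n] by auto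
    moreover have "z = zip (vals z) (map snd z1 @ map snd z2)"
      by (metis map_snd_conv[OF z] zip_map_fst_snd)
    ultimately show "z \<in> (\<lambda>a. zip a (map snd z1 @ map snd z2)) ` {a. set a \<subseteq> {..?n} \<and> length a = ?n}"
      by (rule rev_image_eqI)
  qed
  then show ?thesis by (rule finite_subset) (simp add: finite_lists_length_eq)
qed

theorem conv_breakpoint_sum:
  fixes F :: "letters \<Rightarrow> letters \<Rightarrow> 'a::comm_monoid_add"
  assumes p1: "parking_function (vals z1)" and p2: "parking_function (vals z2)"
  shows "(\<Sum>z\<in>conv z1 z2. \<Sum>i\<in>bps z. F (low i z) (high i z)) =
    (\<Sum>i1\<in>bps z1. \<Sum>i2\<in>bps z2. \<Sum>b\<in>conv (low i1 z1) (low i2 z2).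
       \<Sum>c\<in>conv (high i1 z1) (high i2 z2). F b c)"
proof -
  let ?n = "length z1"
  let ?A = "SIGMA z:conv z1 z2. bps z"
  let ?B = "SIGMA (i1, i2):bps z1 \<times> bps z2.
    conv (low i1 z1) (low i2 z2) \<times> conv (high i1 z1) (high i2 z2)"
  \<comment> \<open>The breakpoints of the two factors are the numbers of small letters in the two
    blocks of \<open>z\<close>; conversely, \<open>?g\<close> cuts at their sum.\<close>
  let ?f = "\<lambda>(z, i). ((cnt (vals (take ?n z)) i, cnt (vals (drop ?n z)) i), low i z, high i z)"
  let ?g = "\<lambda>((i1, i2), b, c). (combine z1 z2 i1 i2 b c, i1 + i2)"
  have "(\<Sum>z\<in>conv z1 z2. \<Sum>i\<in>bps z. F (low i z) (high i z)) =
      (\<Sum>(z, i)\<in>?A. F (low i z) (high i z))"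
    by (rule sum.Sigma) auto
  also have "\<dots> = (\<Sum>((i1, i2), b, c)\<in>?B. F b c)"
  proof (rule sum.reindex_bij_witness[where i = ?g and j = ?f])
    fix x assume "x \<in> ?A"
    then obtain z i where x: "x = (z, i)" "z \<in> conv z1 z2" "i \<in> bps z" by auto
    from x(2) obtain v w where e: "z = v @ w" "z1 = parkize v" "z2 = parkize w"
      and p: "parking_function (vals (v @ w))" by (rule convE)
    have i: "i \<in> bps (v @ w)" using x(3) e(1) by simp
    note c = conv_low_high[OF p i refl refl]
    have tk: "take ?n z = v" "drop ?n z = w" by (simp_all add: e)
    show "?g (?f x) = x" unfolding x(1) prod.case tk using c(1,6) by (simp add: e)
    show "?f x \<in> ?B" unfolding x(1) prod.case tk using c by (simp add: e del: map_append)
    show "(\<lambda>((i1, i2), b, c). F b c) (?f x) = (\<lambda>(z, i). F (low i z) (high i z)) x"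
      by (simp add: x(1))
  next
    fix y assume "y \<in> ?B"
    then obtain i1 i2 b c where y: "y = ((i1, i2), b, c)" and i: "i1 \<in> bps z1" "i2 \<in> bps z2"
      and bc: "b \<in> conv (low i1 z1) (low i2 z2)" "c \<in> conv (high i1 z1) (high i2 z2)" by auto
    note m = combine_conv[OF p1 p2 i bc refl refl, unfolded append_take_drop_id]
    have "combine z1 z2 i1 i2 b c \<in> conv z1 z2"
      using conv_appendI[of "take ?n (combine z1 z2 i1 i2 b c)" "drop ?n (combine z1 z2 i1 i2 b c)"]
        m(1,5,6) by simp
    then show "?g y \<in> ?A" using m(2) by (simp add: y)
    show "?f (?g y) = y" using m(3,4,7,8) by (simp add: y)
  qed
  also have "\<dots> = (\<Sum>(i1, i2)\<in>bps z1 \<times> bps z2.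
      \<Sum>(b, c)\<in>conv (low i1 z1) (low i2 z2) \<times> conv (high i1 z1) (high i2 z2). F b c)"
    by (subst sum.Sigma[symmetric]) (auto simp: split_def)
  finally show ?thesis by (simp add: sum.cartesian_product)
qed

text \<open>Both sides run over the parking functions \<open>u @ v @ w\<close> whose blocks parkize
  to \<open>z1\<close>, \<open>z2\<close>, \<open>z3\<close>. The intermediate term is forced to be
  the parkization of \<open>u @ v\<close> or of \<open>v @ w\<close>, and by
  \<open>parkize_sub\<close> its blocks parkize as the original ones do.\<close>

theorem conv_assoc_sum:
  fixes F :: "letters \<Rightarrow> 'a::comm_monoid_add"
  assumes p1: "parking_function (vals z1)" and p3: "parking_function (vals z3)"
  shows "(\<Sum>a\<in>conv z1 z2. \<Sum>b\<in>conv a z3. F b) = (\<Sum>c\<in>conv z2 z3. \<Sum>b\<in>conv z1 c. F b)"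
proof -
  let ?T = "{u @ v @ w |u v w. parking_function (vals (u @ v @ w)) \<and>
    parkize u = z1 \<and> parkize v = z2 \<and> parkize w = z3}"
  have sub: "parkize (take n (parkize z)) = parkize (take n z)"
    "parkize (drop n (parkize z)) = parkize (drop n z)" if "0 \<notin> set (vals z)" for n z
    using parkize_sub[OF that mset_take_subset, of n] parkize_sub[OF that mset_drop_subset, of n]
    by (simp_all add: parkize_def take_map drop_map)
  have z0: "0 \<notin> set (vals (u @ v))" "0 \<notin> set (vals (v @ w))"
    if "parking_function (vals (u @ v @ w))" for u v w
    using parking_function_pos[OF that] by auto
  have "(\<Sum>a\<in>conv z1 z2. \<Sum>b\<in>conv a z3. F b) = (\<Sum>(a, b)\<in>(SIGMA a:conv z1 z2. conv a z3). F b)"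
    by (rule sum.Sigma) auto
  also have "\<dots> = sum F ?T"
  proof (rule sum.reindex_bij_witness[where j = snd and
        i = "\<lambda>b. (parkize (take (length z1 + length z2) b), b)"])
    fix x assume "x \<in> (SIGMA a:conv z1 z2. conv a z3)"
    then obtain a b where x: "x = (a, b)" "a \<in> conv z1 z2" "b \<in> conv a z3" by auto
    from x(3) obtain y w where b: "b = y @ w" "a = parkize y" "z3 = parkize w"
      and p: "parking_function (vals (y @ w))" by (rule convE)
    have y0: "0 \<notin> set (vals y)" using parking_function_pos[OF p] by auto
    have l: "length y = length z1 + length z2" using x(2) b(2) by (simp add: conv_def)
    show "(parkize (take (length z1 + length z2) (snd x)), snd x) = x"
      using l by (simp add: x(1) b)
    have "parkize (take (length z1) y) = z1" "parkize (drop (length z1) y) = z2"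
      using x(2) unfolding b(2) conv_def by (auto simp: sub[OF y0])
    moreover have "b = take (length z1) y @ drop (length z1) y @ w" using b(1) by simp
    ultimately show "snd x \<in> ?T" using p unfolding x(1) snd_conv b(3) b(1)[symmetric] by blast
    show "F (snd x) = (case x of (a, b) \<Rightarrow> F b)" by (simp add: x(1))
  next
    fix b assume "b \<in> ?T"
    then obtain u v w where b: "b = u @ v @ w" "parking_function (vals (u @ v @ w))"
      "parkize u = z1" "parkize v = z2" "parkize w = z3" by auto
    have l: "length z1 = length u" "length z2 = length v" "length z3 = length w" using b(3-5) by auto
    have "parkize (u @ v) \<in> conv z1 z2"
      using sub[OF z0(1)[OF b(2)], of "length u"] parking_function_parkize[OF z0(1)[OF b(2)]]
      by (simp add: conv_def l b)
    moreover have "b \<in> conv (parkize (u @ v)) z3"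
      using conv_appendI[of "u @ v" w] b by simp
    ultimately show "(parkize (take (length z1 + length z2) b), b) \<in> (SIGMA a:conv z1 z2. conv a z3)"
      by (simp add: l b(1))
  qed auto
  also have "sum F ?T = (\<Sum>(c, b)\<in>(SIGMA c:conv z2 z3. conv z1 c). F b)"
  proof (rule sum.reindex_bij_witness[where i = snd and j = "\<lambda>b. (parkize (drop (length z1) b), b)"])
    fix x assume "x \<in> (SIGMA c:conv z2 z3. conv z1 c)"
    then obtain c b where x: "x = (c, b)" "c \<in> conv z2 z3" "b \<in> conv z1 c" by auto
    from x(3) obtain u y where b: "b = u @ y" "z1 = parkize u" "c = parkize y"
      and p: "parking_function (vals (u @ y))" by (rule convE)
    have y0: "0 \<notin> set (vals y)" using parking_function_pos[OF p] by auto
    show "(parkize (drop (length z1) (snd x)), snd x) = x" by (simp add: x(1) b)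
    have "parkize (take (length z2) y) = z2" "parkize (drop (length z2) y) = z3"
      using x(2) unfolding b(3) conv_def by (auto simp: sub[OF y0])
    moreover have "b = u @ take (length z2) y @ drop (length z2) y" using b(1) by simp
    ultimately show "snd x \<in> ?T" using p unfolding x(1) snd_conv b(2) b(1)[symmetric] by blast
  next
    fix b assume "b \<in> ?T"
    then obtain u v w where b: "b = u @ v @ w" "parking_function (vals (u @ v @ w))"
      "parkize u = z1" "parkize v = z2" "parkize w = z3" by auto
    have l: "length z1 = length u" "length z2 = length v" "length z3 = length w" using b(3-5) by auto
    have "parkize (v @ w) \<in> conv z2 z3"
      using sub[OF z0(2)[OF b(2)], of "length v"] parking_function_parkize[OF z0(2)[OF b(2)]]
      by (simp add: conv_def l b)
    moreover have "b \<in> conv z1 (parkize (v @ w))"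
      using conv_appendI[of u "v @ w"] b by simp
    ultimately show "(parkize (drop (length z1) b), b) \<in> (SIGMA c:conv z2 z3. conv z1 c)"
      by (simp add: l b(1))
  qed auto
  also have "\<dots> = (\<Sum>c\<in>conv z2 z3. \<Sum>b\<in>conv z1 c. F b)"
    by (rule sum.Sigma[symmetric]) auto
  finally show ?thesis .
qed

lemma conv_Nil_left: "parking_function (vals z) \<Longrightarrow> conv [] z = {z}"
  by (auto simp: conv_def parkize_parking_function)

lemma conv_Nil_right: "parking_function (vals z) \<Longrightarrow> conv z [] = {z}"
  by (auto simp: conv_def parkize_parking_function)

section \<open>The bialgebra and its antipode\<close>

definition colored :: "letters \<Rightarrow> colored_word" where
  "colored z = (map fst z, map snd z)"

definition parking_letters :: "nat \<Rightarrow> letters set" where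
  "parking_letters l = {z. parking_function (vals z) \<and> snd ` set z \<subseteq> {1..l}}"

abbreviation G :: "letters \<Rightarrow> (colored_word \<Rightarrow>\<^sub>0 complex)" where
  "G z \<equiv> basis_vec (colored z)"

lemma colored_parking_functions_eq: "colored_parking_functions l = colored ` parking_letters l"
proof
  show "colored_parking_functions l \<subseteq> colored ` parking_letters l"
  proof
    fix p assume p: "p \<in> colored_parking_functions l"
    then obtain a u where "p = (a, u)" "length u = length a" by (auto simp: colored_parking_functions_def)
    then have "p = colored (zip a u)" "zip a u \<in> parking_letters l"
      using p by (auto simp: colored_def colored_parking_functions_def parking_letters_def dest: set_zip_rightD)
    then show "p \<in> colored ` parking_letters l" by blast
  qed
qed (auto simp: colored_def colored_parking_functions_def parking_letters_def)

lemma breakpoints_Nil [simp]: "breakpoints [] = {0}"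
  by (auto simp: breakpoints_eq cnt_def)

lemma colored_in_iff [simp]: "colored z \<in> colored_parking_functions l \<longleftrightarrow> z \<in> parking_letters l"
  by (auto simp: colored_def colored_parking_functions_def parking_letters_def)

lemma csize_colored [simp]: "csize (colored z) = length z"
  by (simp add: csize_def colored_def)

lemma Nil_in_parking_letters [simp]: "[] \<in> parking_letters l"
  by (simp add: parking_letters_def)

lemma parking_lettersD: "z \<in> parking_letters l \<Longrightarrow> parking_function (vals z)"
  by (simp add: parking_letters_def)

lemma conv_in_parking_letters:
  assumes "z \<in> conv z1 z2" "z1 \<in> parking_letters l" "z2 \<in> parking_letters l"
  shows "z \<in> parking_letters l"
proof -
  have "snd ` set z = snd ` set z1 \<union> snd ` set z2"
    using arg_cong[OF map_snd_conv[OF assms(1)], of set] by simp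
  with assms show ?thesis by (auto simp: parking_letters_def conv_def)
qed

lemma low_high_in_parking_letters:
  assumes "z \<in> parking_letters l" "i \<in> bps z"
  shows "low i z \<in> parking_letters l" "high i z \<in> parking_letters l"
proof -
  have "cnt (vals z) i = i" using assms(2) by (simp add: bps_eq)
  then have "parking_function (vals (low i z))" "parking_function (vals (high i z))"
    using parking_function_low_high_iff[of z i] assms(1) by (auto simp: parking_letters_def)
  moreover have "snd ` set (low i z) \<subseteq> snd ` set z" "snd ` set (high i z) \<subseteq> snd ` set z"
    by (auto simp: low_def high_def image_image)
  ultimately show "low i z \<in> parking_letters l" "high i z \<in> parking_letters l"
    using assms(1) unfolding parking_letters_def mem_Collect_eq by (blast intro: subset_trans)+
qed

lemma crestrict_colored:
  "crestrict (colored z) i j =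
    (park (vals (filter (\<lambda>p. fst p \<in> {i..j}) z)), map snd (filter (\<lambda>p. fst p \<in> {i..j}) z))"
proof -
  let ?K = "{k. k < length z \<and> fst (z ! k) \<in> {i..j}}"
  have "{k. k < length (vals z) \<and> vals z ! k \<in> {i..j}} = ?K" by auto
  moreover have "filter (\<lambda>p. fst p \<in> {i..j}) z = nths z ?K" by (rule filter_eq_nths)
  ultimately show ?thesis by (simp only: crestrict_def colored_def prod.case Let_def nths_map)
qed

lemma high_zero: "0 \<notin> set (vals z) \<Longrightarrow> high 0 z = z"
proof -
  assume "0 \<notin> set (vals z)"
  then have "filter (\<lambda>p. 0 < fst p) z = z" by (intro filter_True) (metis gr0I image_eqI set_map)
  then show ?thesis by (simp add: high_def apfst_def map_prod_def map_idI)
qed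

lemma crestrict_low:
  assumes "parking_function (vals z)" "i \<in> bps z"
  shows "crestrict (colored z) 1 i = colored (low i z)"
proof -
  have "filter (\<lambda>p. fst p \<in> {1..i}) z = low i z"
    unfolding low_def using parking_function_pos[OF assms(1)] by (intro filter_cong) (force simp: Suc_le_eq)+
  moreover have "parking_function (vals (low i z))"
    using parking_function_low_high_iff[of z i] assms by (auto simp: bps_eq)
  ultimately show ?thesis
    unfolding crestrict_colored by (simp only: colored_def park_parking_function)
qed

text \<open>\<open>crestrict\<close> parkizes the large letters \<open>?u\<close> unshifted. Having
  no letter up to \<open>i\<close>, the word \<open>?u\<close> is tight at \<open>i\<close> with
  count 0, so \<open>high_parkize\<close> with the cut moved to 0 identifies its parkization with
  the shifted word.\<close>

lemma crestrict_high:
  assumes "parking_function (vals z)" "i \<in> bps z"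
  shows "crestrict (colored z) (i + 1) (length z) = colored (high i z)"
proof -
  let ?u = "filter (\<lambda>p. i < fst p) z"
  have "\<forall>x\<in>set (vals z). x \<le> length z"
    using parking_function_cnt_length[OF assms(1)] cnt_eq_length_iff[of "vals z" "length z"] by simp
  then have f: "filter (\<lambda>p. fst p \<in> {i + 1..length z}) z = ?u"
    by (intro filter_cong) auto
  have u0: "0 \<notin> set (vals ?u)" by auto
  have c0: "cnt (vals ?u) i = 0" by (auto simp: cnt_def filter_empty_conv)
  then have t: "tight (vals ?u) i" by (simp add: tight_def)
  have h: "high i ?u = high i z" by (simp add: high_def)
  have q: "parking_function (vals (high i z))"
    using parking_function_low_high_iff[of z i] assms by (auto simp: bps_eq)
  have "parkize ?u = high 0 (parkize ?u)"
    using high_zero[OF parking_function_pos[OF parking_function_parkize[OF u0]]] by simp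
  also have "\<dots> = high i z"
    using high_parkize[OF t u0] by (simp add: c0 h parkize_parking_function q)
  finally have "vals (high i z) = park (vals ?u)" "map snd (high i z) = map snd ?u"
    using vals_parkize[OF u0] map_snd_parkize[of ?u] by simp_all
  then show ?thesis unfolding crestrict_colored f by (simp only: colored_def)
qed

text \<open>Attaching the color word \<open>?u\<close> by \<open>zip\<close> is inverse to
  forgetting colors, because the colors of a term of \<open>conv z1 z2\<close> are forced.\<close>

lemma pq_mult_G: "pq_mult (G z1) (G z2) = (\<Sum>z\<in>conv z1 z2. G z)"
proof -
  let ?u = "map snd z1 @ map snd z2"
  have "pq_mult (G z1) (G z2) = (\<Sum>a\<in>convolution (vals z1) (vals z2). basis_vec (a, ?u))"
    by (simp add: pq_mult_def colored_def)
  also have "\<dots> = (\<Sum>z\<in>conv z1 z2. G z)"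
  proof (rule sum.reindex_bij_witness[where i = "map fst" and j = "\<lambda>a. zip a ?u"])
    fix a assume a: "a \<in> convolution (vals z1) (vals z2)"
    then have l: "length a = length z1 + length z2" and p: "parking_function a"
      and pk: "park (take (length z1) a) = vals z1" "park (drop (length z1) a) = vals z2"
      by (auto simp: convolution_def)
    show fz: "vals (zip a ?u) = a" using l by simp
    show "G (zip a ?u) = basis_vec (a, ?u)" using l by (simp add: colored_def)
    have a0: "0 \<notin> set (take (length z1) a)" "0 \<notin> set (drop (length z1) a)"
      using parking_function_pos[OF p] by (auto dest: in_set_takeD in_set_dropD)
    have "parkize (take (length z1) (zip a ?u)) = z1"
      using l a0 pk by (intro letters_eqI) (simp_all add: vals_parkize take_zip del: set_map)
    moreover have "parkize (drop (length z1) (zip a ?u)) = z2"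
      using l a0 pk by (intro letters_eqI) (simp_all add: vals_parkize drop_zip del: set_map)
    ultimately show "zip a ?u \<in> conv z1 z2" using p l by (simp add: conv_def fz)
  next
    fix z assume z: "z \<in> conv z1 z2"
    show "zip (vals z) ?u = z" by (metis map_snd_conv[OF z] zip_map_fst_snd)
    from z obtain v w where "z = v @ w" "z1 = parkize v" "z2 = parkize w" "parking_function (vals (v @ w))"
      by (rule convE)
    moreover from this have "0 \<notin> set (vals v)" "0 \<notin> set (vals w)"
      using parking_function_pos[of "vals (v @ w)"] by auto
    ultimately show "vals z \<in> convolution (vals z1) (vals z2)"
      by (simp add: convolution_def vals_parkize del: set_map)
  qed
  finally show ?thesis .
qed

lemma pq_comult_G:
  assumes "parking_function (vals z)"
  shows "pq_comult (G z) = (\<Sum>i\<in>bps z. basis_vec (colored (low i z), colored (high i z)))"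
proof -
  have "pq_comult (G z) = (\<Sum>i\<in>bps z. basis_vec (crestrict (colored z) 1 i, crestrict (colored z) (i + 1) (length z)))"
    by (simp add: pq_comult_def) (simp add: colored_def)
  then show ?thesis using crestrict_low[OF assms] crestrict_high[OF assms] by (simp cong: sum.cong)
qed

lemma pq_one_eq: "pq_one = G []"
  by (simp add: pq_one_def colored_def)

lemma pq_counit_G: "pq_counit (G z) = (if z = [] then 1 else 0)"
  by (auto simp: pq_counit_def colored_def lookup_basis_vec)

section \<open>Algebra axioms, and multiplicativity of coproduct and counit\<close>

lemma pq_linear:
  "linear_on scale scale UNIV (\<lambda>x. pq_mult x y)" "linear_on scale scale UNIV (pq_mult x)"
  "linear_on scale scale UNIV pq_comult" "linear_on scale (*) UNIV pq_counit"
  "linear_on scale scale UNIV (\<lambda>x. tensor_mult m x y')" "linear_on scale scale UNIV (tensor_mult m x')"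
  unfolding pq_mult_def pq_comult_def tensor_mult_def
  by (rule linear_on_bilin_ext_left linear_on_bilin_ext_right linear_on_lin_ext
    | simp add: linear_on_def pq_counit_def lookup_add)+

lemma pq_mult_sum_left: "pq_mult (sum f A) y = (\<Sum>a\<in>A. pq_mult (f a) y)"
  and pq_mult_sum_right: "pq_mult x (sum f A) = (\<Sum>a\<in>A. pq_mult x (f a))"
  and pq_comult_sum: "pq_comult (sum g A) = (\<Sum>a\<in>A. pq_comult (g a))"
  and pq_counit_sum: "pq_counit (sum g A) = (\<Sum>a\<in>A. pq_counit (g a))"
  by (simp_all add: linear_on_sum[OF pq_linear(1)] linear_on_sum[OF pq_linear(2)]
    linear_on_sum[OF pq_linear(3)] linear_on_sum[OF pq_linear(4)])

lemma G_in_PQSym: "z \<in> parking_letters l \<Longrightarrow> G z \<in> PQSym l"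
  by simp

lemma pq_mult_in_PQSym:
  assumes "x \<in> PQSym l" "y \<in> PQSym l"
  shows "pq_mult x y \<in> PQSym l"
proof -
  have "pq_mult (basis_vec p) (basis_vec q) \<in> PQSym l"
    if "p \<in> colored_parking_functions l" "q \<in> colored_parking_functions l" for p q
  proof -
    from that obtain z1 z2 where "p = colored z1" "q = colored z2"
      and z: "z1 \<in> parking_letters l" "z2 \<in> parking_letters l"
      by (auto simp: colored_parking_functions_eq)
    then show ?thesis
      using conv_in_parking_letters[OF _ z] by (auto simp only: pq_mult_G intro!: space_on_sum G_in_PQSym)
  qed
  then show ?thesis
    using assms unfolding pq_mult_def by (intro bilin_ext_in_space_on) auto
qed

lemma pq_mult_one:
  assumes "x \<in> PQSym l"
  shows "pq_mult pq_one x = x" "pq_mult x pq_one = x"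
proof -
  show "pq_mult pq_one x = x"
    by (rule linear_on_eqI[OF pq_linear(2) linear_on_ident assms])
      (auto simp: colored_parking_functions_eq pq_one_eq pq_mult_G conv_Nil_left parking_lettersD)
  show "pq_mult x pq_one = x"
    by (rule linear_on_eqI[OF pq_linear(1) linear_on_ident assms])
      (auto simp: colored_parking_functions_eq pq_one_eq pq_mult_G conv_Nil_right parking_lettersD)
qed

lemma pq_mult_assoc:
  assumes x: "x \<in> PQSym l" and y: "y \<in> PQSym l" and z: "z \<in> PQSym l"
  shows "pq_mult (pq_mult x y) z = pq_mult x (pq_mult y z)"
proof (rule bilinear_on_eqI[where f = "\<lambda>x y. pq_mult (pq_mult x y) z" and
      g = "\<lambda>x y. pq_mult x (pq_mult y z)", OF _ _ _ _ x y])
  fix p q assume pq: "p \<in> colored_parking_functions l" "q \<in> colored_parking_functions l"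
  show "pq_mult (pq_mult (basis_vec p) (basis_vec q)) z = pq_mult (basis_vec p) (pq_mult (basis_vec q) z)"
  proof (rule linear_on_eqI[OF _ _ z])
    fix r assume "r \<in> colored_parking_functions l"
    with pq obtain z1 z2 z3 where "p = colored z1" "q = colored z2" "r = colored z3"
      "z1 \<in> parking_letters l" "z3 \<in> parking_letters l"
      by (auto simp: colored_parking_functions_eq)
    then show "pq_mult (pq_mult (basis_vec p) (basis_vec q)) (basis_vec r) =
        pq_mult (basis_vec p) (pq_mult (basis_vec q) (basis_vec r))"
      using conv_assoc_sum[of z1 z3 G z2]
      by (simp add: pq_mult_G pq_mult_sum_left pq_mult_sum_right parking_lettersD)
  qed (rule pq_linear linear_on_compose[OF pq_linear(2)])+
qed (rule pq_linear linear_on_compose[OF pq_linear(1) pq_linear(1)]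
   linear_on_compose[OF pq_linear(1) pq_linear(2)] linear_on_compose[OF pq_linear(2) pq_linear(1)])+

lemma pq_comult_pq_mult:
  assumes x: "x \<in> PQSym l" and y: "y \<in> PQSym l"
  shows "pq_comult (pq_mult x y) = tensor_mult pq_mult (pq_comult x) (pq_comult y)"
proof (rule bilinear_on_eqI[where f = "\<lambda>x y. pq_comult (pq_mult x y)" and
      g = "\<lambda>x y. tensor_mult pq_mult (pq_comult x) (pq_comult y)", OF _ _ _ _ x y])
  fix p q assume "p \<in> colored_parking_functions l" "q \<in> colored_parking_functions l"
  then obtain z1 z2 where e: "p = colored z1" "q = colored z2"
    and p: "parking_function (vals z1)" "parking_function (vals z2)"
    by (auto simp: colored_parking_functions_eq dest: parking_lettersD)
  have "pq_comult (pq_mult (G z1) (G z2)) =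
      (\<Sum>z\<in>conv z1 z2. \<Sum>i\<in>bps z. basis_vec (colored (low i z), colored (high i z)))"
    by (simp add: pq_mult_G pq_comult_sum pq_comult_G conv_def)
  also have "\<dots> = (\<Sum>i1\<in>bps z1. \<Sum>i2\<in>bps z2. \<Sum>b\<in>conv (low i1 z1) (low i2 z2).
       \<Sum>c\<in>conv (high i1 z1) (high i2 z2). basis_vec (colored b, colored c))"
    by (rule conv_breakpoint_sum[OF p])
  also have "\<dots> = (\<Sum>i1\<in>bps z1. \<Sum>i2\<in>bps z2.
      tensor (pq_mult (G (low i1 z1)) (G (low i2 z2))) (pq_mult (G (high i1 z1)) (G (high i2 z2))))"
    unfolding pq_mult_G tensor_def bilin_ext_sum_left by (simp add: bilin_ext_sum_right)
  also have "\<dots> = tensor_mult pq_mult (pq_comult (G z1)) (pq_comult (G z2))"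
    unfolding pq_comult_G[OF p(1)] pq_comult_G[OF p(2)] tensor_mult_def bilin_ext_sum_left
    by (simp add: bilin_ext_sum_right)
  finally show "pq_comult (pq_mult (basis_vec p) (basis_vec q)) =
      tensor_mult pq_mult (pq_comult (basis_vec p)) (pq_comult (basis_vec q))"
    by (simp add: e)
qed (rule linear_on_compose[OF pq_linear(3) pq_linear(1)] linear_on_compose[OF pq_linear(3) pq_linear(2)]
    linear_on_compose[OF pq_linear(5) pq_linear(3)] linear_on_compose[OF pq_linear(6) pq_linear(3)])+

lemma conv_length: "z \<in> conv z1 z2 \<Longrightarrow> length z = length z1 + length z2"
  by (simp add: conv_def)

lemma pq_counit_pq_mult:
  assumes x: "x \<in> PQSym l" and y: "y \<in> PQSym l"
  shows "pq_counit (pq_mult x y) = pq_counit x * pq_counit y"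
proof (rule bilinear_on_eqI[where f = "\<lambda>x y. pq_counit (pq_mult x y)" and
      g = "\<lambda>x y. pq_counit x * pq_counit y", OF _ _ _ _ x y])
  fix p q assume "p \<in> colored_parking_functions l" "q \<in> colored_parking_functions l"
  then obtain z1 z2 where e: "p = colored z1" "q = colored z2"
    by (auto simp: colored_parking_functions_eq)
  have "pq_counit (pq_mult (G z1) (G z2)) = pq_counit (G z1) * pq_counit (G z2)"
  proof (cases "z1 = [] \<and> z2 = []")
    case True
    then show ?thesis by (simp add: pq_mult_G conv_Nil_left pq_counit_G)
  next
    case False
    then have "z \<noteq> []" if "z \<in> conv z1 z2" for z using conv_length[OF that] by auto
    then show ?thesis using False by (auto simp: pq_mult_G pq_counit_sum pq_counit_G)
  qed
  then show "pq_counit (pq_mult (basis_vec p) (basis_vec q)) = pq_counit (basis_vec p) * pq_counit (basis_vec q)"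
    by (simp add: e)
qed (rule linear_on_compose[OF pq_linear(4) pq_linear(1)] linear_on_compose[OF pq_linear(4) pq_linear(2)]
    | simp add: linear_on_def pq_counit_def lookup_add algebra_simps)+

section \<open>Coalgebra axioms\<close>

lemma pq_comult_in_space:
  assumes "x \<in> PQSym l"
  shows "pq_comult x \<in> space_on (colored_parking_functions l \<times> colored_parking_functions l)"
proof -
  have "pq_comult (basis_vec p) \<in> space_on (colored_parking_functions l \<times> colored_parking_functions l)"
    if "p \<in> colored_parking_functions l" for p
  proof -
    from that obtain z where "p = colored z" and z: "z \<in> parking_letters l"
      by (auto simp: colored_parking_functions_eq)
    then show ?thesis
      using low_high_in_parking_letters[OF z]
      by (auto simp: pq_comult_G parking_lettersD intro!: space_on_sum)
  qed
  with assms show ?thesis unfolding pq_comult_def by (intro lin_ext_in_space_on) auto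
qed

lemma low_length: "parking_function (vals z) \<Longrightarrow> low (length z) z = z"
  using parking_function_cnt_length[of "vals z"] cnt_eq_length_iff[of "vals z" "length z"]
  by (simp add: low_def)

lemma high_length: "parking_function (vals z) \<Longrightarrow> high (length z) z = []"
  using parking_function_cnt_length[of "vals z"] unfolding length_0_conv[symmetric] by simp

lemma low_zero: "0 \<notin> set (vals z) \<Longrightarrow> low 0 z = []"
  unfolding length_0_conv[symmetric] by (simp add: cnt_zero del: set_map)

lemma zero_in_bps: "parking_function (vals z) \<Longrightarrow> 0 \<in> bps z"
  by (simp add: bps_eq cnt_zero parking_function_pos del: set_map)

lemma length_in_bps: "parking_function (vals z) \<Longrightarrow> length z \<in> bps z"
  using parking_function_cnt_length[of "vals z"] by (simp add: bps_eq)

lemma length_low_bps: "i \<in> bps z \<Longrightarrow> length (low i z) = i"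
  by (simp add: bps_eq)

lemma length_high_bps: "i \<in> bps z \<Longrightarrow> length (high i z) = length z - i"
  by (simp add: bps_eq)

lemma bps_le_length: "i \<in> bps z \<Longrightarrow> i \<le> length z"
  by (simp add: bps_eq)

text \<open>The breakpoints of a piece are those of \<open>z\<close> on its side of the cut, so both
  sides run over pairs of breakpoints of \<open>z\<close> that cut it into three pieces. On the
  right the second one is counted from the first, hence \<open>i - j\<close> in the reindexing.
  Besides coassociativity, this regroups the sums comparing the two antipodes.\<close>

theorem double_breakpoint_sum:
  fixes F :: "letters \<Rightarrow> letters \<Rightarrow> letters \<Rightarrow> 'a::comm_monoid_add"
  shows "(\<Sum>i\<in>bps z. \<Sum>j\<in>bps (low i z). F (low j (low i z)) (high j (low i z)) (high i z)) =
    (\<Sum>i\<in>bps z. \<Sum>j\<in>bps (high i z). F (low i z) (low j (high i z)) (high j (high i z)))"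
proof -
  let ?A = "SIGMA i:bps z. bps (low i z)" and ?B = "SIGMA i:bps z. bps (high i z)"
  have "(\<Sum>(i, j)\<in>?A. F (low j (low i z)) (high j (low i z)) (high i z)) =
      (\<Sum>(i, j)\<in>?B. F (low i z) (low j (high i z)) (high j (high i z)))"
    by (rule sum.reindex_bij_witness[where j = "\<lambda>(i, j). (j, i - j)" and i = "\<lambda>(i, j). (i + j, i)"])
      (auto simp: bps_low bps_high low_low high_high low_high min.absorb2)
  then show ?thesis by (simp add: sum.Sigma)
qed

lemma tensor_map_sum: "tensor_map f g (sum h A) = (\<Sum>a\<in>A. tensor_map f g (h a))"
  by (simp add: tensor_map_def lin_ext_sum)

lemma tensor_map_basis_vec:
  "tensor_map f g (basis_vec (b, c)) = tensor (f (basis_vec b)) (g (basis_vec c))"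
  by (simp add: tensor_map_def)

lemma pq_coassoc:
  assumes x: "x \<in> PQSym l"
  shows "tensor_assoc (tensor_map pq_comult id (pq_comult x)) = tensor_map id pq_comult (pq_comult x)"
proof (rule linear_on_eqI[OF _ _ x])
  fix p assume "p \<in> colored_parking_functions l"
  then obtain z where e: "p = colored z" and z: "z \<in> parking_letters l"
    by (auto simp: colored_parking_functions_eq)
  note p = parking_lettersD[OF z] parking_lettersD[OF low_high_in_parking_letters(1)[OF z]]
    parking_lettersD[OF low_high_in_parking_letters(2)[OF z]]
  show "tensor_assoc (tensor_map pq_comult id (pq_comult (basis_vec p))) =
      tensor_map id pq_comult (pq_comult (basis_vec p))"
    using double_breakpoint_sum[of "\<lambda>a b c. basis_vec (colored a, colored b, colored c)" z]
    by (simp add: e pq_comult_G p tensor_map_sum tensor_map_basis_vec tensor_assoc_def lin_ext_sum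
        lin_ext_tensor bilin_ext_sum_left tensor_def bilin_ext_sum_right)
qed (unfold tensor_map_def tensor_assoc_def,
  (rule linear_on_compose[OF linear_on_lin_ext linear_on_compose[OF linear_on_lin_ext pq_linear(3)]]
    linear_on_compose[OF linear_on_lin_ext pq_linear(3)])+)

text \<open>As \<open>low i z\<close> has length \<open>i\<close>, it is nonempty at every
  breakpoint but 0. Sums weighted by the counit collapse in this way.\<close>

lemma sum_bps_zero:
  fixes F :: "nat \<Rightarrow> 'a::comm_monoid_add"
  assumes p: "parking_function (vals z)" and F: "\<And>i. i \<in> bps z \<Longrightarrow> low i z \<noteq> [] \<Longrightarrow> F i = 0"
  shows "sum F (bps z) = F 0"
proof -
  have "F i = 0" if "i \<in> bps z - {0}" for i
    using F[of i] length_low_bps[of i z] that by (metis DiffE list.size(3) singletonI)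
  then show ?thesis
    using sum.mono_neutral_right[of "bps z" "{0}" F] zero_in_bps[OF p] by simp
qed

lemma sum_bps_length:
  fixes F :: "nat \<Rightarrow> 'a::comm_monoid_add"
  assumes p: "parking_function (vals z)" and F: "\<And>i. i \<in> bps z \<Longrightarrow> high i z \<noteq> [] \<Longrightarrow> F i = 0"
  shows "sum F (bps z) = F (length z)"
proof -
  have "F i = 0" if "i \<in> bps z - {length z}" for i
  proof -
    have "length (high i z) \<noteq> 0"
      using length_high_bps[of i z] bps_le_length[of i z] that by simp
    with F[of i] that show ?thesis by (metis DiffD1 list.size(3))
  qed
  then show ?thesis
    using sum.mono_neutral_right[of "bps z" "{length z}" F] length_in_bps[OF p] by simp
qed

lemma pq_counit_left:
  assumes x: "x \<in> PQSym l"
  shows "lin_ext (\<lambda>(b, c). scale (pq_counit (basis_vec b)) (basis_vec c)) (pq_comult x) = x"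
proof (rule linear_on_eqI[OF linear_on_compose[OF linear_on_lin_ext pq_linear(3)] linear_on_ident x])
  fix p assume "p \<in> colored_parking_functions l"
  then obtain z where e: "p = colored z" and p: "parking_function (vals z)"
    by (auto simp: colored_parking_functions_eq dest: parking_lettersD)
  show "lin_ext (\<lambda>(b, c). scale (pq_counit (basis_vec b)) (basis_vec c)) (pq_comult (basis_vec p)) = basis_vec p"
    by (simp add: e pq_comult_G p lin_ext_sum pq_counit_G sum_bps_zero low_zero high_zero parking_function_pos del: set_map)
qed

lemma pq_counit_right:
  assumes x: "x \<in> PQSym l"
  shows "lin_ext (\<lambda>(b, c). scale (pq_counit (basis_vec c)) (basis_vec b)) (pq_comult x) = x"
proof (rule linear_on_eqI[OF linear_on_compose[OF linear_on_lin_ext pq_linear(3)] linear_on_ident x])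
  fix p assume "p \<in> colored_parking_functions l"
  then obtain z where e: "p = colored z" and p: "parking_function (vals z)"
    by (auto simp: colored_parking_functions_eq dest: parking_lettersD)
  show "lin_ext (\<lambda>(b, c). scale (pq_counit (basis_vec c)) (basis_vec b)) (pq_comult (basis_vec p)) = basis_vec p"
    by (simp add: e pq_comult_G p lin_ext_sum pq_counit_G sum_bps_length low_length high_length)
qed


theorem graded_bialgebra_pq:
  "graded_bialgebra_on (colored_parking_functions l) pq_mult pq_one pq_comult pq_counit csize"
proof -
  let ?B = "colored_parking_functions l"
  have one: "pq_one \<in> PQSym l" by (simp add: pq_one_eq G_in_PQSym)
  have one_comult: "pq_comult pq_one = tensor pq_one pq_one"
    by (simp add: pq_one_eq pq_comult_G sum_bps_zero[of "[]"] low_def high_def)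
  have hom: "algebra_hom scale (PQSym l) pq_mult pq_one scale (space_on (?B \<times> ?B))
      (tensor_mult pq_mult) (tensor pq_one pq_one) pq_comult"
    unfolding algebra_hom_def
    by (auto simp: linear_on_subset[OF pq_linear(3)] pq_comult_in_space pq_comult_pq_mult one_comult)
  have counit: "algebra_hom scale (PQSym l) pq_mult pq_one (*) UNIV (*) 1 pq_counit"
    unfolding algebra_hom_def
    by (auto simp: linear_on_subset[OF pq_linear(4)] pq_counit_pq_mult pq_one_eq pq_counit_G)
  interpret bialgebra_on ?B pq_mult pq_one pq_comult pq_counit
    using pq_linear one hom counit
    by unfold_locales (auto intro: linear_on_subset pq_mult_in_PQSym pq_mult_assoc pq_comult_in_space
        simp: pq_mult_one pq_coassoc pq_counit_left pq_counit_right)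
  let ?D = "\<lambda>n. {b \<in> ?B. csize b = n}"
  show ?thesis
  proof
    fix x y m n assume x: "x \<in> space_on (?D m)" and y: "y \<in> space_on (?D n)"
    have "pq_mult (basis_vec p) (basis_vec q) \<in> space_on (?D (m + n))" if "p \<in> ?D m" "q \<in> ?D n" for p q
    proof -
      from that obtain z1 z2 where e: "p = colored z1" "q = colored z2" "length z1 = m" "length z2 = n"
        and z: "z1 \<in> parking_letters l" "z2 \<in> parking_letters l"
        by (auto simp: colored_parking_functions_eq)
      show ?thesis
        unfolding e(1,2) pq_mult_G using conv_in_parking_letters[OF _ z] conv_length e(3,4)
        by (auto intro!: space_on_sum)
    qed
    with x y show "pq_mult x y \<in> space_on (?D (m + n))"
      unfolding pq_mult_def by (intro bilin_ext_in_space_on) auto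
  next
    show "pq_one \<in> space_on (?D 0)" by (simp add: pq_one_eq colored_in_iff)
  next
    fix x n assume x: "x \<in> space_on (?D n)"
    have "pq_comult (basis_vec p) \<in> space_on {(b, c) \<in> ?B \<times> ?B. csize b + csize c = n}"
      if "p \<in> ?D n" for p
    proof -
      from that obtain z where e: "p = colored z" "length z = n" and z: "z \<in> parking_letters l"
        by (auto simp: colored_parking_functions_eq)
      show ?thesis
        unfolding e(1) pq_comult_G[OF parking_lettersD[OF z]]
        using low_high_in_parking_letters[OF z] e(2)
        by (intro space_on_sum) (auto simp: bps_eq)
    qed
    with x show "pq_comult x \<in> space_on {(b, c) \<in> ?B \<times> ?B. csize b + csize c = n}"
      unfolding pq_comult_def by (intro lin_ext_in_space_on) auto
  next
    fix x n assume "x \<in> space_on (?D n)" "n \<noteq> 0"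
    then show "pq_counit x = 0"
      by (auto simp: space_on_def pq_counit_def csize_def in_keys_iff subset_iff)
  qed
qed

text \<open>
  Left and right convolution inverse of the identity, obtained by solving the defining equation
  for the top degree part; they coincide by associativity.
\<close>

function left_antipode :: "letters \<Rightarrow> (colored_word \<Rightarrow>\<^sub>0 complex)" where
  "left_antipode z = (if z = [] then pq_one else
     - (\<Sum>i\<in>{i \<in> bps z. i < length z}. pq_mult (left_antipode (low i z)) (G (high i z))))"
  by auto
termination by (relation "measure length") (auto simp: bps_eq)

function right_antipode :: "letters \<Rightarrow> (colored_word \<Rightarrow>\<^sub>0 complex)" where
  "right_antipode z = (if z = [] then pq_one else
     - (\<Sum>i\<in>{i \<in> bps z. 0 < i}. pq_mult (G (low i z)) (right_antipode (high i z))))"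
  by auto
termination by (relation "measure length") (auto simp: bps_eq)

declare left_antipode.simps [simp del] right_antipode.simps [simp del]

section \<open>Antipode\<close>

lemma left_antipode_in_PQSym: "z \<in> parking_letters l \<Longrightarrow> left_antipode z \<in> PQSym l"
proof (induction z rule: left_antipode.induct)
  case (1 z)
  have "pq_mult (left_antipode (low i z)) (G (high i z)) \<in> PQSym l" if "i \<in> bps z" "i < length z" "z \<noteq> []" for i
    using 1 that low_high_in_parking_letters[OF 1(2) that(1)]
    by (intro pq_mult_in_PQSym G_in_PQSym) auto
  then show ?case
    by (subst left_antipode.simps) (auto simp: pq_one_eq G_in_PQSym intro!: space_on_uminus space_on_sum)
qed

lemma right_antipode_in_PQSym: "z \<in> parking_letters l \<Longrightarrow> right_antipode z \<in> PQSym l"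
proof (induction z rule: right_antipode.induct)
  case (1 z)
  have "pq_mult (G (low i z)) (right_antipode (high i z)) \<in> PQSym l" if "i \<in> bps z" "0 < i" "z \<noteq> []" for i
    using 1 that low_high_in_parking_letters[OF 1(2) that(1)]
    by (intro pq_mult_in_PQSym G_in_PQSym) auto
  then show ?case
    by (subst right_antipode.simps) (auto simp: pq_one_eq G_in_PQSym intro!: space_on_uminus space_on_sum)
qed

text \<open>The summand at \<open>i = length z\<close> is \<open>left_antipode z\<close> times the
  unit, and the recursion makes it cancel all other summands; the empty word has no others.\<close>

lemma left_antipode_sum:
  assumes z: "z \<in> parking_letters l"
  shows "(\<Sum>i\<in>bps z. pq_mult (left_antipode (low i z)) (G (high i z))) = (if z = [] then pq_one else 0)"
proof -
  note p = parking_lettersD[OF z]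
  have top: "pq_mult (left_antipode (low (length z) z)) (G (high (length z) z)) = left_antipode z"
    using pq_mult_one(2)[OF left_antipode_in_PQSym[OF z]] by (simp add: low_length[OF p] high_length[OF p] pq_one_eq)
  have "bps z = insert (length z) {i \<in> bps z. i < length z}"
    using length_in_bps[OF p] bps_le_length[of _ z] by fastforce
  then have "(\<Sum>i\<in>bps z. pq_mult (left_antipode (low i z)) (G (high i z))) =
     left_antipode z + (\<Sum>i\<in>{i \<in> bps z. i < length z}. pq_mult (left_antipode (low i z)) (G (high i z)))"
    by (subst (1) \<open>bps z = _\<close>, subst sum.insert) (simp_all add: top)
  then show ?thesis by (simp add: left_antipode.simps[of z])
qed

lemma right_antipode_sum:
  assumes z: "z \<in> parking_letters l"
  shows "(\<Sum>i\<in>bps z. pq_mult (G (low i z)) (right_antipode (high i z))) = (if z = [] then pq_one else 0)"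
proof -
  note p = parking_lettersD[OF z]
  have top: "pq_mult (G (low 0 z)) (right_antipode (high 0 z)) = right_antipode z"
    using pq_mult_one(1)[OF right_antipode_in_PQSym[OF z]]
    by (simp add: low_zero high_zero parking_function_pos[OF p] pq_one_eq del: set_map)
  have "bps z = insert 0 {i \<in> bps z. 0 < i}"
    using zero_in_bps[OF p] by auto
  then have "(\<Sum>i\<in>bps z. pq_mult (G (low i z)) (right_antipode (high i z))) =
     right_antipode z + (\<Sum>i\<in>{i \<in> bps z. 0 < i}. pq_mult (G (low i z)) (right_antipode (high i z)))"
    by (subst (1) \<open>bps z = _\<close>, subst sum.insert) (simp_all add: top)
  then show ?thesis
    using top right_antipode.simps[of z] by (cases "z = []") simp_all
qed

text \<open>On a basis element this is the computation R = (L * id) * R = L * (id * R) = L in the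
  convolution algebra; the middle step combines \<open>double_breakpoint_sum\<close> and
  \<open>pq_mult_assoc\<close>.\<close>

lemma left_antipode_eq_right_antipode:
  assumes z: "z \<in> parking_letters l"
  shows "left_antipode z = right_antipode z"
proof -
  let ?L = left_antipode and ?R = right_antipode
  note p = parking_lettersD[OF z]
  note lh = low_high_in_parking_letters
  have "?R z = pq_mult pq_one (?R z)"
    using pq_mult_one(1)[OF right_antipode_in_PQSym[OF z]] by simp
  \<comment> \<open>The unit is spread over all breakpoints with zeros away from 0, so that
    \<open>left_antipode_sum\<close> can be inserted in every summand.\<close>
  also have "\<dots> = (\<Sum>i\<in>bps z. pq_mult (if low i z = [] then pq_one else 0) (?R (high i z)))"
    by (subst sum_bps_zero[OF p])
      (simp_all add: low_zero high_zero parking_function_pos[OF p] pq_mult_def del: set_map)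
  also have "\<dots> = (\<Sum>i\<in>bps z. \<Sum>j\<in>bps (low i z).
      pq_mult (pq_mult (?L (low j (low i z))) (G (high j (low i z)))) (?R (high i z)))"
    using lh[OF z] by (intro sum.cong refl) (simp only: left_antipode_sum[where l = l, symmetric] pq_mult_sum_left)
  also have "\<dots> = (\<Sum>i\<in>bps z. \<Sum>j\<in>bps (high i z).
      pq_mult (pq_mult (?L (low i z)) (G (low j (high i z)))) (?R (high j (high i z))))"
    by (rule double_breakpoint_sum)
  also have "\<dots> = (\<Sum>i\<in>bps z. \<Sum>j\<in>bps (high i z).
      pq_mult (?L (low i z)) (pq_mult (G (low j (high i z))) (?R (high j (high i z)))))"
    using lh[OF z] lh
    by (intro sum.cong refl pq_mult_assoc[of _ l] left_antipode_in_PQSym right_antipode_in_PQSym G_in_PQSym) blast+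
  also have "\<dots> = (\<Sum>i\<in>bps z. pq_mult (?L (low i z)) (if high i z = [] then pq_one else 0))"
    using lh[OF z] by (intro sum.cong refl) (simp only: right_antipode_sum[where l = l, symmetric] pq_mult_sum_right)
  also have "\<dots> = pq_mult (?L z) pq_one"
    by (subst sum_bps_length[OF p]) (simp_all add: low_length[OF p] high_length[OF p] pq_mult_def)
  also have "\<dots> = ?L z"
    using pq_mult_one(2)[OF left_antipode_in_PQSym[OF z]] by simp
  finally show ?thesis by simp
qed

lemma mult_lin_sum: "mult_lin m (sum f A) = (\<Sum>a\<in>A. mult_lin m (f a))"
  by (simp add: mult_lin_def lin_ext_sum)

lemma mult_lin_tensor: "mult_lin pq_mult (tensor x y) = pq_mult x y"
  by (simp add: mult_lin_def lin_ext_tensor pq_mult_def)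

theorem hopf_algebra_pq:
  "hopf_algebra_on (colored_parking_functions l) pq_mult pq_one pq_comult pq_counit"
proof -
  let ?B = "colored_parking_functions l"
  interpret graded_bialgebra_on ?B pq_mult pq_one pq_comult pq_counit csize
    by (rule graded_bialgebra_pq)
  \<comment> \<open>\<open>zip\<close> recovers the letters of a colored parking function; it
    truncates only on pairs of unequal lengths, which lie outside \<open>?B\<close>.\<close>
  define S where "S = lin_ext (\<lambda>(a, u). left_antipode (zip a u))"
  have SG: "S (G z) = left_antipode z" for z
    by (simp add: S_def colored_def zip_map_fst_snd)
  have "S (basis_vec p) \<in> PQSym l" if "p \<in> ?B" for p
  proof -
    from that obtain z where "p = colored z" "z \<in> parking_letters l"
      by (auto simp: colored_parking_functions_eq)
    then show ?thesis using left_antipode_in_PQSym by (simp add: SG)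
  qed
  then have S_mem: "S x \<in> PQSym l" if "x \<in> PQSym l" for x
    using that unfolding S_def by (auto intro: lin_ext_in_space_on)
  have lin: "linear_on scale scale UNIV (\<lambda>x. mult_lin pq_mult (tensor_map f g (pq_comult x)))" for f g
    unfolding mult_lin_def tensor_map_def
    by (rule linear_on_compose[OF linear_on_lin_ext linear_on_compose[OF linear_on_lin_ext pq_linear(3)]])
  have lin_unit: "linear_on scale scale UNIV (\<lambda>x. scale (pq_counit x) pq_one)"
    using pq_linear(4) by (simp add: linear_on_def scale_add_left)
  have "mult_lin pq_mult (tensor_map S id (pq_comult x)) = scale (pq_counit x) pq_one"
    if x: "x \<in> PQSym l" for x
  proof (rule linear_on_eqI[OF lin lin_unit x])
    fix p assume "p \<in> ?B"
    then obtain z where e: "p = colored z" and z: "z \<in> parking_letters l"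
      by (auto simp: colored_parking_functions_eq)
    show "mult_lin pq_mult (tensor_map S id (pq_comult (basis_vec p))) = scale (pq_counit (basis_vec p)) pq_one"
      using left_antipode_sum[OF z]
      by (simp add: e pq_comult_G parking_lettersD[OF z] tensor_map_sum tensor_map_basis_vec
          mult_lin_sum mult_lin_tensor SG pq_counit_G)
  qed
  moreover have "mult_lin pq_mult (tensor_map id S (pq_comult x)) = scale (pq_counit x) pq_one"
    if x: "x \<in> PQSym l" for x
  proof (rule linear_on_eqI[OF lin lin_unit x])
    fix p assume "p \<in> ?B"
    then obtain z where e: "p = colored z" and z: "z \<in> parking_letters l"
      by (auto simp: colored_parking_functions_eq)
    \<comment> \<open>\<open>S\<close> is built from the left inverse, so the second identity needs
      both inverses to agree on \<open>high i z\<close>, which again lies in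
      \<open>parking_letters l\<close>.\<close>
    have "S (G (high i z)) = right_antipode (high i z)" if "i \<in> bps z" for i
      using left_antipode_eq_right_antipode[OF low_high_in_parking_letters(2)[OF z that]] by (simp add: SG)
    then show "mult_lin pq_mult (tensor_map id S (pq_comult (basis_vec p))) = scale (pq_counit (basis_vec p)) pq_one"
      using right_antipode_sum[OF z]
      by (simp add: e pq_comult_G parking_lettersD[OF z] tensor_map_sum tensor_map_basis_vec
          mult_lin_sum mult_lin_tensor pq_counit_G cong: sum.cong)
  qed
  moreover have "linear_on scale scale (PQSym l) S"
    unfolding S_def by (rule linear_on_lin_ext)
  ultimately show ?thesis
    using S_mem by unfold_locales blast
qed

theorem theorem6p1:
  fixes l :: nat
  assumes "l \<ge> 1"
  shows "algebra_hom scale (PQSym l) pq_mult pq_one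
           scale (space_on (colored_parking_functions l \<times> colored_parking_functions l))
           (tensor_mult pq_mult) (tensor pq_one pq_one) pq_comult
         \<and> graded_bialgebra_on (colored_parking_functions l)
           pq_mult pq_one pq_comult pq_counit csize
         \<and> hopf_algebra_on (colored_parking_functions l)
           pq_mult pq_one pq_comult pq_counit"
proof -
  interpret graded_bialgebra_on "colored_parking_functions l" pq_mult pq_one pq_comult pq_counit csize
    by (rule graded_bialgebra_pq)
  show ?thesis
    using comult_hom graded_bialgebra_pq hopf_algebra_pq by blast
qed

end
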